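(* For every $n\in\mathbb{N}$, the ambient homeomorphism equivalence relation $R_n$ on $\mathcal{K}([0,1]^n)$ is Borel reducible to the homeomorphism equivalence relation on $\mathsf{C}_n([0,1]^{n+1})$. In particular $R_n\le_B C_{n+1}$.
   Context: $\mathcal{K}(X)$ is the space of compact subsets of $X$ with the Vietoris topology; $\mathsf{C}_n(X)$ is the Borel subspace of continua (nonempty connected compacta) in $X$ of covering dimension exactly $n$. $R_n$ is the relation on $\mathcal{K}([0,1]^n)$ given by $K\,R_n\,L$ iff there is a self-homeomorphism $g$ of $[0,1]^n$ with $g(K)=L$. $C_n$ is the homeomorphism relation on $\mathsf{C}([0,1]^n)$ ($K,L$ related iff homeomorphic). $E\le_B F$ means there is a Borel map $f$ with $xEx'\iff f(x)Ff(x')$.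
   Formalization: The formal theorem is stated for n ≥ 1 only; for n = 0 the claim fails, since R_0 on K([0,1]^0) has two classes (the empty set and the point) while all 0-dimensional continua in [0,1] are single points. *)

theory Defs
  imports "HOL-Analysis.Analysis" "HOL-Probability.Probability"
begin

definition unit_cube :: "(real^'n) set" where
  "unit_cube = {x. \<forall>i. 0 \<le> x $ i \<and> x $ i \<le> 1}"

definition hyperspace :: "'a::topological_space set \<Rightarrow> 'a set set" where
  "hyperspace X = {K. compact K \<and> K \<subseteq> X}"

definition vietoris :: "'a::topological_space set \<Rightarrow> 'a set topology" where
  "vietoris X = topology_generated_by
     ({{K \<in> hyperspace X. K \<subseteq> U} | U. open U} \<union> {{K \<in> hyperspace X. K \<inter> U \<noteq> {}} | U. open U})"

definition borel_of_top :: "'a topology \<Rightarrow> 'a measure" where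
  "borel_of_top T = sigma (topspace T) {U. openin T U}"

definition covering_dim_le :: "'a::topological_space set \<Rightarrow> nat \<Rightarrow> bool" where
  "covering_dim_le X n \<longleftrightarrow>
     (\<forall>\<U>. finite \<U> \<and> (\<forall>U\<in>\<U>. openin (top_of_set X) U) \<and> X \<subseteq> \<Union>\<U> \<longrightarrow>
        (\<exists>\<V>. finite \<V> \<and> (\<forall>V\<in>\<V>. openin (top_of_set X) V) \<and> X \<subseteq> \<Union>\<V> \<and>
              (\<forall>V\<in>\<V>. \<exists>U\<in>\<U>. V \<subseteq> U) \<and>
              (\<forall>x\<in>X. card {V\<in>\<V>. x \<in> V} \<le> n + 1)))"

text \<open>Covering dimension exactly n (for n \<ge> 1; the empty set has dimension -1).\<close>
definition covering_dim_eq :: "'a::topological_space set \<Rightarrow> nat \<Rightarrow> bool" where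
  "covering_dim_eq X n \<longleftrightarrow> X \<noteq> {} \<and> covering_dim_le X n \<and>
      (n = 0 \<or> \<not> covering_dim_le X (n - 1))"

definition continua :: "'a::topological_space set \<Rightarrow> 'a set set" where
  "continua X = {K. K \<in> hyperspace X \<and> K \<noteq> {} \<and> connected K}"

definition continua_dim :: "nat \<Rightarrow> 'a::topological_space set \<Rightarrow> 'a set set" where
  "continua_dim n X = {K \<in> continua X. covering_dim_eq K n}"

definition ambient_homeo :: "(real^'n) set \<Rightarrow> (real^'n) set \<Rightarrow> bool" where
  "ambient_homeo K L \<longleftrightarrow> (\<exists>g h. homeomorphism unit_cube unit_cube g h \<and> g ` K = L)"

definition borel_reducible ::
  "'a topology \<Rightarrow> ('a \<Rightarrow> 'a \<Rightarrow> bool) \<Rightarrow> 'b topology \<Rightarrow> ('b \<Rightarrow> 'b \<Rightarrow> bool) \<Rightarrow> bool" where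
  "borel_reducible TA E TB F \<longleftrightarrow>
     (\<exists>f. f \<in> measurable (borel_of_top TA) (borel_of_top TB) \<and>
          (\<forall>x\<in>topspace TA. \<forall>y\<in>topspace TA. E x y \<longleftrightarrow> F (f x) (f y)))"

end

theory Submission
  imports Defs
begin

text \<open>
  Transport \<open>K\<close> to a subset \<open>A\<close> of the unit ball \<open>C\<close> inside the ball \<open>D\<close> of radius \<open>2\<close>.
  Over the base \<open>D \<times> {0}\<close> stack, for every \<open>m\<close>, a group of three copies of \<open>D\<close> at relative heights
  \<open>2^{-m}\<close>, \<open>2^{-m}(1 + \<alpha>)\<close> and \<open>2^{-m}(1 + \<alpha> + \<beta>)\<close>, everything being collapsed to the base over the
  sphere of radius \<open>2\<close>; here \<open>\<alpha>\<close> vanishes exactly on \<open>C\<close> and \<open>\<beta>\<close> exactly on \<open>A\<close>. The resulting continuum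
  depends continuously on \<open>A\<close>, and up to homeomorphism only on the triple \<open>(D, C, A)\<close>; a homeomorphism of
  the pair \<open>(C, A)\<close> extends radially to \<open>D\<close>. Conversely, the base is the closure of the set of points where
  the continuum is not connected im kleinen, the groups are the components of its complement, and near a
  point of the base a group has one branch over \<open>C \<inter> A\<close>, two over the rest of \<open>C \<union> A\<close>, and three
  elsewhere. Hence \<open>C\<close> and \<open>A\<close> are recovered topologically.

  The continuum contains a copy of the \<open>n\<close>-cube, which has covering dimension \<open>n\<close> by Brouwer's theorem,
  and it is a compact subset of \<open>(n+1)\<close>-space with empty interior. After a translation such a set misses
  all rational points, and these contain the points where \<open>n + 2\<close> tiles dual to (a refinement of) the
  Freudenthal triangulation meet; so its dimension is at most \<open>n\<close>.
\<close>

section \<open>Covering dimension\<close>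

text \<open>Gluing all layers to the base over the sphere of radius 2 makes the space connected, but
  there the number of branches says nothing. As \<open>K\<close> may touch the boundary of the cube,
  its copy A has to be kept inside a larger ball D; then C is no longer visible by itself and must
  be marked too. This is why a group has three copies: \<alpha> marks C and \<beta> marks A. Only
  the zero sets of \<alpha> and \<beta> matter for the homeomorphism type, since they decide which
  layers coincide over a point. So the values may be taken from distances, which depend continuously
  on A. They are kept so small that the factors 1, 1 + \<alpha> and 1 + \<alpha> + \<beta> stay
  below 3/2, while consecutive heights differ by the factor 2; hence the groups never touch over the
  open ball. The empty set is an exceptional A, because its distance function is 0 by convention. It
  is an isolated point of the hyperspace, so continuity survives, and its layered space is told
  apart by a separate argument.\<close>

lemma covering_dim_le_injective_image:
  fixes e :: "'a::t2_space \<Rightarrow> 'b::t2_space"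
  assumes "compact B" "continuous_on B e" "inj_on e B" "e ` B \<subseteq> X" "covering_dim_le X k"
  shows "covering_dim_le B k"
  unfolding covering_dim_le_def
proof (intro allI impI, elim conjE)
  fix \<U> assume fin: "finite \<U>" and op: "\<forall>U\<in>\<U>. openin (top_of_set B) U" and cov: "B \<subseteq> \<Union>\<U>"
  show "\<exists>\<V>. finite \<V> \<and> (\<forall>V\<in>\<V>. openin (top_of_set B) V) \<and> B \<subseteq> \<Union>\<V> \<and>
     (\<forall>V\<in>\<V>. \<exists>U\<in>\<U>. V \<subseteq> U) \<and> (\<forall>x\<in>B. card {V \<in> \<V>. x \<in> V} \<le> k + 1)"
  \<comment> \<open>Points of \<open>X\<close> outside the image of \<open>B\<close> lie in
    \<open>O' U\<close> for every \<open>U\<close>, so the enlarged family covers them only if some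
    \<open>U\<close> exists.\<close>
  proof (cases "\<U> = {}")
    case True
    then show ?thesis using cov by (intro exI[of _ "{}"]) auto
  next
    case False
    \<comment> \<open>As \<open>B\<close> is compact, \<open>e\<close> is a closed embedding:
      \<open>O' U\<close> is open in \<open>X\<close>, and its preimage in \<open>B\<close> lies in
      \<open>U\<close>. A refinement of the cover by these sets can be pulled back.\<close>
    define O' where "O' U = X - e ` (B - U)" for U
    have opO: "openin (top_of_set X) (O' U)" if "U \<in> \<U>" for U
    proof -
      have "closedin (top_of_set B) (B - U)"
        using op that by (simp add: closedin_diff)
      then have "compact (B - U)"
        using assms(1) closedin_compact by blast
      then have "compact (e ` (B - U))"
        using assms(2) by (meson Diff_subset compact_continuous_image continuous_on_subset)
      then have "closed (e ` (B - U))"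
        by (rule compact_imp_closed)
      then show ?thesis
        unfolding O'_def by (simp add: Diff_eq openin_open_Int open_Compl)
    qed
    have covO: "X \<subseteq> \<Union>(O' ` \<U>)"
    proof
      fix x assume "x \<in> X"
      show "x \<in> \<Union>(O' ` \<U>)"
      proof (cases "x \<in> e ` B")
        case True
        then obtain b where b: "b \<in> B" "x = e b" by blast
        with cov obtain U where "U \<in> \<U>" "b \<in> U" by blast
        moreover have "x \<notin> e ` (B - U)"
          using b \<open>b \<in> U\<close> assms(3) by (auto simp: inj_on_def)
        ultimately show ?thesis using \<open>x \<in> X\<close> unfolding O'_def by blast
      next
        case no: False
        then show ?thesis using False \<open>x \<in> X\<close> unfolding O'_def by blast
      qed
    qed
    have "finite (O' ` \<U>)" using fin by simp
    then obtain \<V> where V: "finite \<V>" "\<And>V. V\<in>\<V> \<Longrightarrow> openin (top_of_set X) V" "X \<subseteq> \<Union>\<V>"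
        "\<And>V. V\<in>\<V> \<Longrightarrow> \<exists>U\<in>O' ` \<U>. V \<subseteq> U" "\<And>x. x\<in>X \<Longrightarrow> card {V\<in>\<V>. x \<in> V} \<le> k + 1"
      using assms(5)[unfolded covering_dim_le_def, rule_format, of "O' ` \<U>"] opO covO by auto
    define \<W> where "\<W> = (\<lambda>V. B \<inter> e -` V) ` \<V>"
    show ?thesis
    proof (intro exI[of _ \<W>] conjI ballI)
      show "finite \<W>" using V(1) by (simp add: \<W>_def)
      show "openin (top_of_set B) W" if "W \<in> \<W>" for W
        using that V(2) continuous_openin_preimage[OF assms(2), of X] assms(4) unfolding \<W>_def by blast
      show "B \<subseteq> \<Union>\<W>"
        using V(3) assms(4) unfolding \<W>_def by fastforce
      show "\<exists>U\<in>\<U>. W \<subseteq> U" if "W \<in> \<W>" for W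
      proof -
        from that obtain V where "V \<in> \<V>" "W = B \<inter> e -` V" unfolding \<W>_def by blast
        moreover with V(4) obtain U where "U \<in> \<U>" "V \<subseteq> O' U" by blast
        ultimately show ?thesis unfolding O'_def by (intro bexI[of _ U]) auto
      qed
      show "card {W \<in> \<W>. x \<in> W} \<le> k + 1" if "x \<in> B" for x
      proof -
        have "{W \<in> \<W>. x \<in> W} \<subseteq> (\<lambda>V. B \<inter> e -` V) ` {V \<in> \<V>. e x \<in> V}"
          unfolding \<W>_def by auto
        then have "card {W \<in> \<W>. x \<in> W} \<le> card {V \<in> \<V>. e x \<in> V}"
          using surj_card_le[of "{V \<in> \<V>. e x \<in> V}"] V(1) by simp
        also have "\<dots> \<le> k + 1" using V(5) assms(4) that by blast
        finally show ?thesis .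
      qed
    qed
  qed
qed

section \<open>Lower bound: Lebesgue's covering theorem for the cube\<close>

lemma unit_cube_eq_cbox: "unit_cube = (cbox 0 1 :: (real^'n) set)"
  by (auto simp: unit_cube_def mem_box_cart)

lemma empty_interior_finite_Union_closed:
  assumes "finite \<F>" "\<And>S. S \<in> \<F> \<Longrightarrow> closed S" "\<And>S. S \<in> \<F> \<Longrightarrow> interior S = {}"
  shows "interior (\<Union>\<F>) = {}"
  using assms
proof (induction \<F> rule: finite_induct)
  case (insert S \<F>)
  then have "interior (S \<union> \<Union>\<F>) = interior S"
    by (intro interior_closed_Un_empty_interior) auto
  with insert show ?case by auto
qed auto

text \<open>The Poincare--Miranda theorem, specialised to maps respecting opposite faces.\<close>

lemma face_preserving_onto:
  fixes F :: "real^'n \<Rightarrow> real^'n"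
  assumes cont: "continuous_on unit_cube F"
    and low: "\<And>x i. x \<in> unit_cube \<Longrightarrow> x $ i = 0 \<Longrightarrow> F x $ i = 0"
    and high: "\<And>x i. x \<in> unit_cube \<Longrightarrow> x $ i = 1 \<Longrightarrow> F x $ i = 1"
  shows "box 0 1 \<subseteq> F ` unit_cube"
proof
  fix y :: "real^'n" assume y: "y \<in> box 0 1"
  \<comment> \<open>\<open>H\<close> is the step from \<open>x\<close> by \<open>y - F x\<close>,
    clamped to the cube, so a fixed point solves \<open>F x = y\<close> unless the clamp acts on it.
    That could happen only on a face, and there the face conditions together with 0 <
    \<open>y $ i\<close> < 1 make the step point inwards.\<close>
  define H where "H x = (\<chi> i. max 0 (min 1 (x $ i - (F x $ i - y $ i))))" for x
  have "continuous_on unit_cube H"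
    unfolding H_def by (intro continuous_intros cont)
  moreover have "H \<in> unit_cube \<rightarrow> unit_cube"
    by (auto simp: H_def unit_cube_def)
  moreover have "compact (unit_cube :: (real^'n) set)" "convex (unit_cube :: (real^'n) set)"
    "(unit_cube :: (real^'n) set) \<noteq> {}"
    by (auto simp: unit_cube_eq_cbox box_ne_empty(1) mem_box_cart Basis_vec_def inner_axis)
  ultimately obtain x where x: "x \<in> unit_cube" "H x = x"
    using brouwer by metis
  have "F x $ i = y $ i" for i
  proof -
    have y': "0 < y $ i" "y $ i < 1" using y by (auto simp: mem_box_cart)
    have "x $ i = max 0 (min 1 (x $ i - (F x $ i - y $ i)))"
      using x(2) unfolding H_def by (metis vec_lambda_beta)
    moreover have "0 \<le> x $ i" "x $ i \<le> 1" using x(1) by (auto simp: unit_cube_def)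
    ultimately show ?thesis
      using low[OF x(1), of i] high[OF x(1), of i] y' by (auto simp: max_def min_def split: if_splits)
  qed
  then have "F x = y" by (simp add: vec_eq_iff)
  with x(1) show "y \<in> F ` unit_cube" by blast
qed

text \<open>A refinement of small order gives, through a partition of unity, a map of the cube into
  finitely many convex sets without interior. If its members are too small to join opposite faces
  and are sent to suitable vertices of the cube, this map preserves faces and is therefore onto the
  open cube.\<close>

lemma not_covering_dim_le_unit_cube:
  "\<not> covering_dim_le (unit_cube :: (real^'n) set) (CARD('n) - 1)"
proof
  let ?Q = "unit_cube :: (real^'n) set"
  assume dim: "covering_dim_le ?Q (CARD('n) - 1)"
  have cpt: "compact ?Q" by (simp add: unit_cube_eq_cbox)
  \<comment> \<open>Two points of a ball of radius 1/2 are less than 1 apart, so no member of a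
    refinement meets two opposite faces.\<close>
  obtain T where T: "T \<subseteq> ?Q" "finite T" "?Q \<subseteq> (\<Union>c\<in>T. ball c (1/2))"
    using compactE_image[OF cpt, of ?Q "\<lambda>c. ball c (1/2)"] by force
  define \<U> where "\<U> = (\<lambda>c. ?Q \<inter> ball c (1/2)) ` T"
  have "finite \<U> \<and> (\<forall>U\<in>\<U>. openin (top_of_set ?Q) U) \<and> ?Q \<subseteq> \<Union>\<U>"
    using T unfolding \<U>_def by auto
  then obtain \<V> where V: "finite \<V>" "\<And>V. V\<in>\<V> \<Longrightarrow> openin (top_of_set ?Q) V" "?Q \<subseteq> \<Union>\<V>"
        "\<And>V. V\<in>\<V> \<Longrightarrow> \<exists>U\<in>\<U>. V \<subseteq> U" "\<And>x. x\<in>?Q \<Longrightarrow> card {V\<in>\<V>. x \<in> V} \<le> CARD('n) - 1 + 1"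
    using dim[unfolded covering_dim_le_def, rule_format, of \<U>] by auto
  have faces: False if "V \<in> \<V>" "x \<in> V" "y \<in> V" "x $ i = 0" "y $ i = 1" for V x y i
  proof -
    from V(4)[OF that(1)] obtain c where "V \<subseteq> ball c (1/2)" unfolding \<U>_def by blast
    then have "dist c x < 1/2" "dist c y < 1/2" using that(2,3) by auto
    then have "dist x y < 1" by (rule dist_triangle_half_r)
    moreover have "\<bar>(x - y) $ i\<bar> \<le> norm (x - y)" by (rule component_le_norm_cart)
    ultimately show False using that by (simp add: dist_norm)
  qed
  \<comment> \<open>A member that meets the face \<open>x $ i = 1\<close> cannot meet the opposite
    one and so receives 1; a member that meets the face \<open>x $ i = 0\<close> receives 0. This is
    what makes \<open>F\<close> preserve faces.\<close>
  define p :: "(real^'n) set \<Rightarrow> real^'n" where "p V = (\<chi> i. if \<exists>x\<in>V. x $ i = 0 then 0 else 1)" for V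
  define \<phi> where "\<phi> V x = infdist x (?Q - V)" for V x
  \<comment> \<open>\<open>infdist\<close> to the empty set is 0, so the distance to the complement
    detects \<open>V\<close> only if that complement is nonempty. A member equal to the cube would
    join opposite faces.\<close>
  have ne: "?Q - V \<noteq> {}" if "V \<in> \<V>" for V
  proof
    assume "?Q - V = {}"
    then have "(0::real^'n) \<in> V" "(1::real^'n) \<in> V" by (auto simp: unit_cube_def)
    then show False using faces[OF that, of 0 1] by simp
  qed
  have clo: "closed (?Q - V)" if "V \<in> \<V>" for V
  proof -
    have "closedin (top_of_set ?Q) (?Q - V)" using V(2)[OF that] by (simp add: closedin_diff)
    then show ?thesis using cpt closedin_compact compact_imp_closed by blast
  qed
  have \<phi>0: "\<phi> V x = 0 \<longleftrightarrow> x \<notin> V" if "V \<in> \<V>" "x \<in> ?Q" for V x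
    using in_closed_iff_infdist_zero[OF clo[OF that(1)] ne[OF that(1)], of x] that(2) by (auto simp: \<phi>_def)
  have \<phi>_ge: "0 \<le> \<phi> V x" for V x by (simp add: \<phi>_def infdist_nonneg)
  define s where "s x = (\<Sum>V\<in>\<V>. \<phi> V x)" for x
  have spos: "0 < s x" if "x \<in> ?Q" for x
  proof -
    obtain V where "V \<in> \<V>" "x \<in> V" using V(3) \<open>x \<in> ?Q\<close> by blast
    then have "0 < \<phi> V x" using \<phi>0[of V x] \<phi>_ge[of V x] that by (simp add: less_le)
    then show ?thesis unfolding s_def
      by (rule sum_pos2[OF V(1) \<open>V \<in> \<V>\<close>]) (simp add: \<phi>_ge)
  qed
  define F where "F x = (\<Sum>V\<in>\<V>. (\<phi> V x / s x) *\<^sub>R p V)" for x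
  have sum1: "(\<Sum>V\<in>\<V>. \<phi> V x / s x) = 1" if "x \<in> ?Q" for x
    using spos[OF that] by (simp add: s_def flip: sum_divide_distrib)
  have Fi: "F x $ i = (\<Sum>V\<in>\<V>. \<phi> V x / s x * p V $ i)" for x i
    by (simp add: F_def)
  have "continuous_on ?Q F"
    unfolding F_def s_def \<phi>_def
    by (intro continuous_intros) (metis spos[unfolded s_def \<phi>_def] less_irrefl)
  moreover have "F x $ i = 0" if "x \<in> ?Q" "x $ i = 0" for x i
    unfolding Fi
  proof (rule sum.neutral, rule ballI)
    fix V assume "V \<in> \<V>"
    then show "\<phi> V x / s x * p V $ i = 0"
      using \<phi>0[of V x] that by (cases "x \<in> V") (auto simp: p_def)
  qed
  moreover have "F x $ i = 1" if "x \<in> ?Q" "x $ i = 1" for x i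
  proof -
    have "F x $ i = (\<Sum>V\<in>\<V>. \<phi> V x / s x)"
      unfolding Fi
    proof (rule sum.cong[OF refl])
      fix V assume "V \<in> \<V>"
      then show "\<phi> V x / s x * p V $ i = \<phi> V x / s x"
        using \<phi>0[of V x] that faces[of V _ x i] by (cases "x \<in> V") (auto simp: p_def)
    qed
    then show ?thesis using sum1 that by simp
  qed
  ultimately have onto: "box 0 1 \<subseteq> F ` ?Q" by (rule face_preserving_onto)
  \<comment> \<open>At most \<open>CARD('n)\<close> members contain a given point, and the convex
    hull of at most \<open>CARD('n)\<close> points lies in a proper affine subspace.\<close>
  define \<S> where "\<S> = {S. S \<subseteq> p ` \<V> \<and> card S \<le> CARD('n)}"
  have finS: "finite \<S>" unfolding \<S>_def using V(1) by simp
  have "F ` ?Q \<subseteq> \<Union>((hull) convex ` \<S>)"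
  proof clarify
    fix x assume x: "x \<in> ?Q"
    define \<V>x where "\<V>x = {V\<in>\<V>. x \<in> V}"
    have fx: "finite \<V>x" and sub: "\<V>x \<subseteq> \<V>" using V(1) by (auto simp: \<V>x_def)
    have "F x = (\<Sum>V\<in>\<V>x. (\<phi> V x / s x) *\<^sub>R p V)"
      unfolding F_def by (rule sum.mono_neutral_right[OF V(1) sub]) (use \<phi>0 x in \<open>auto simp: \<V>x_def\<close>)
    also have "\<dots> \<in> convex hull (p ` \<V>x)"
    proof (rule convex_sum[OF fx convex_convex_hull])
      show "(\<Sum>V\<in>\<V>x. \<phi> V x / s x) = 1"
        unfolding sum1[OF x, symmetric]
        by (rule sum.mono_neutral_left[OF V(1) sub]) (use \<phi>0 x in \<open>auto simp: \<V>x_def\<close>)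
    qed (use spos[OF x] \<phi>_ge in \<open>auto intro: hull_inc\<close>)
    finally have "F x \<in> convex hull (p ` \<V>x)" .
    moreover have "card (p ` \<V>x) \<le> CARD('n)"
      using card_image_le[OF fx, of p] V(5)[OF x] unfolding \<V>x_def by simp
    ultimately show "F x \<in> \<Union>((hull) convex ` \<S>)"
      using image_mono[OF sub, of p] unfolding \<S>_def by (intro UnionI[OF imageI]) auto
  qed
  moreover have "interior (\<Union>((hull) convex ` \<S>)) = {}"
  proof (rule empty_interior_finite_Union_closed)
    show "finite ((hull) convex ` \<S>)" using finS by simp
    fix C assume "C \<in> (hull) convex ` \<S>"
    then obtain S where S: "C = convex hull S" "S \<subseteq> p ` \<V>" "card S \<le> CARD('n)"
      unfolding \<S>_def by blast
    then have "finite S" using V(1) finite_subset by blast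
    then show "closed C" "interior C = {}"
      using S empty_interior_convex_hull[of S]
      by (auto simp: finite_imp_compact_convex_hull compact_imp_closed)
  qed
  ultimately have "interior (box 0 (1::real^'n)) = {}"
    using onto by (metis interior_mono order_trans subset_empty)
  moreover have "(\<chi> i. 1/2) \<in> box 0 (1::real^'n)" by (simp add: mem_box_cart)
  ultimately show False by (metis interior_open open_box empty_iff)
qed

text \<open>The closed sets are fattened to open ones. Any \<open>k + 2\<close> members have no
  common point in the compact \<open>X\<close>, so the sum of their distance functions has a
  positive lower bound there; fattening each by at most an equal share of it cannot create a point
  common to all of them.\<close>

lemma covering_dim_le_closed_covers:
  fixes X :: "'a::metric_space set"
  assumes "compact X"
    and covers: "\<And>\<epsilon>. 0 < \<epsilon> \<Longrightarrow> \<exists>\<F>. finite \<F> \<and> (\<forall>F\<in>\<F>. closed F \<and> (\<forall>x\<in>F. \<forall>y\<in>F. dist x y < \<epsilon>)) \<and>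
        X \<subseteq> \<Union>\<F> \<and> (\<forall>x\<in>X. card {F\<in>\<F>. x \<in> F} \<le> k + 1)"
  shows "covering_dim_le X k"
  unfolding covering_dim_le_def
proof (intro allI impI, elim conjE)
  fix \<U> assume fin: "finite \<U>" and op: "\<forall>U\<in>\<U>. openin (top_of_set X) U" and cov: "X \<subseteq> \<Union>\<U>"
  have "\<exists>G. \<forall>U\<in>\<U>. open (G U) \<and> U = X \<inter> G U"
    using op unfolding openin_open by metis
  then obtain G where G: "\<And>U. U \<in> \<U> \<Longrightarrow> open (G U)" "\<And>U. U \<in> \<U> \<Longrightarrow> U = X \<inter> G U" by blast
  have "X \<subseteq> \<Union>(G ` \<U>)" using cov G(2) by blast
  then obtain \<epsilon> where \<epsilon>: "0 < \<epsilon>" "\<And>x. x \<in> X \<Longrightarrow> \<exists>U\<in>\<U>. ball x \<epsilon> \<subseteq> G U"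
    using G(1) by (elim Heine_Borel_lemma[OF assms(1), of "G ` \<U>"]) auto
  obtain \<F>0 where F0: "finite \<F>0" "\<And>F. F\<in>\<F>0 \<Longrightarrow> closed F"
      "\<And>F x y. F\<in>\<F>0 \<Longrightarrow> x \<in> F \<Longrightarrow> y \<in> F \<Longrightarrow> dist x y < \<epsilon> / 2"
      "X \<subseteq> \<Union>\<F>0" "\<And>x. x\<in>X \<Longrightarrow> card {F\<in>\<F>0. x \<in> F} \<le> k + 1"
  proof -
    assume *: thesis if "finite \<F>0" "\<And>F. F\<in>\<F>0 \<Longrightarrow> closed F"
      "\<And>F x y. F\<in>\<F>0 \<Longrightarrow> x \<in> F \<Longrightarrow> y \<in> F \<Longrightarrow> dist x y < \<epsilon> / 2"
      "X \<subseteq> \<Union>\<F>0" "\<And>x. x\<in>X \<Longrightarrow> card {F\<in>\<F>0. x \<in> F} \<le> k + 1" for \<F>0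
    show thesis
      using covers[OF half_gt_zero[OF \<epsilon>(1)]] by (elim exE conjE) (rule *; blast)
  qed
  \<comment> \<open>Members missing \<open>X\<close> are dropped. Each remaining one contains a
    point of \<open>X\<close>, whose Lebesgue ball selects a member of the given cover, and is
    nonempty, so that \<open>infdist\<close> measures a genuine distance.\<close>
  define \<F> where "\<F> = {F \<in> \<F>0. X \<inter> F \<noteq> {}}"
  have F: "finite \<F>" "\<And>F. F\<in>\<F> \<Longrightarrow> closed F" "\<And>F. F\<in>\<F> \<Longrightarrow> F \<inter> X \<noteq> {}"
      "X \<subseteq> \<Union>\<F>" "\<And>x. x\<in>X \<Longrightarrow> card {F\<in>\<F>. x \<in> F} \<le> k + 1"
  proof -
    show "card {F\<in>\<F>. x \<in> F} \<le> k + 1" if "x \<in> X" for x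
    proof -
      have "card {F\<in>\<F>. x \<in> F} \<le> card {F\<in>\<F>0. x \<in> F}"
        by (rule card_mono) (use F0(1) in \<open>auto simp: \<F>_def\<close>)
      with F0(5)[OF that] show ?thesis by simp
    qed
    show "X \<subseteq> \<Union>\<F>" using F0(4) unfolding \<F>_def by blast
  qed (use F0 in \<open>auto simp: \<F>_def\<close>)
  define \<J> where "\<J> = {J. J \<subseteq> \<F> \<and> card J = k + 2}"
  have finJ: "finite \<J>" unfolding \<J>_def using F(1) by simp
  have ex\<mu>: "\<exists>\<mu>>0. \<forall>x\<in>X. \<mu> \<le> (\<Sum>F\<in>J. infdist x F)" if J: "J \<in> \<J>" for J
  proof (cases "X = {}")
    case False
    have "continuous_on X (\<lambda>x. \<Sum>F\<in>J. infdist x F)" by (intro continuous_intros)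
    then obtain x where x: "x \<in> X" "\<And>y. y \<in> X \<Longrightarrow> (\<Sum>F\<in>J. infdist x F) \<le> (\<Sum>F\<in>J. infdist y F)"
      using continuous_attains_inf[OF assms(1) False] by blast
    have finJ1: "finite J" using J F(1) finite_subset unfolding \<J>_def by blast
    have "\<exists>F\<in>J. x \<notin> F"
    proof (rule ccontr)
      assume "\<not> (\<exists>F\<in>J. x \<notin> F)"
      then have "J \<subseteq> {F\<in>\<F>. x \<in> F}" using J unfolding \<J>_def by auto
      then have "card J \<le> card {F\<in>\<F>. x \<in> F}" using F(1) by (intro card_mono) auto
      also have "\<dots> \<le> k + 1" using F(5) x(1) by blast
      finally show False using J unfolding \<J>_def by simp
    qed
    then obtain F' where F': "F' \<in> J" "x \<notin> F'" by blast
    then have "F' \<in> \<F>" using J unfolding \<J>_def by blast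
    then have "infdist x F' \<noteq> 0"
      using in_closed_iff_infdist_zero[of F' x] F(2,3)[of F'] F'(2) by auto
    then have "0 < infdist x F'" using infdist_nonneg[of x F'] by simp
    then have "0 < (\<Sum>F\<in>J. infdist x F)"
      by (rule sum_pos2[OF finJ1 F'(1)]) (simp add: infdist_nonneg)
    with x(2) show ?thesis by blast
  qed (auto intro: exI[of _ 1])
  then obtain \<mu> where \<mu>: "\<And>J. J \<in> \<J> \<Longrightarrow> 0 < \<mu> J" "\<And>J x. J \<in> \<J> \<Longrightarrow> x \<in> X \<Longrightarrow> \<mu> J \<le> (\<Sum>F\<in>J. infdist x F)"
    by metis
  \<comment> \<open>Points of one member are less than \<open>\<epsilon> / 2\<close> apart, so
    fattening by at most \<open>\<epsilon> / 2\<close> keeps it inside a Lebesgue ball.\<close>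
  define \<eta> where "\<eta> = Min (insert (\<epsilon>/2) ((\<lambda>J. \<mu> J / (k + 2)) ` \<J>))"
  have \<eta>: "0 < \<eta>" "\<eta> \<le> \<epsilon> / 2" "\<And>J. J \<in> \<J> \<Longrightarrow> \<eta> \<le> \<mu> J / (k + 2)"
  proof -
    have fin: "finite (insert (\<epsilon>/2) ((\<lambda>J. \<mu> J / (k + 2)) ` \<J>))" using finJ by simp
    show "0 < \<eta>" unfolding \<eta>_def using fin \<epsilon>(1) \<mu>(1) by (subst Min_gr_iff) auto
    show "\<eta> \<le> \<epsilon> / 2" unfolding \<eta>_def by (rule Min_le[OF fin]) simp
    show "\<eta> \<le> \<mu> J / (k + 2)" if "J \<in> \<J>" for J
      unfolding \<eta>_def by (rule Min_le[OF fin]) (use that in simp)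
  qed
  define W where "W F = {x \<in> X. infdist x F < \<eta>}" for F
  have Wop: "openin (top_of_set X) (W F)" for F
  proof -
    have "open {x. infdist x F < \<eta>}"
      by (intro open_Collect_less continuous_intros)
    then show ?thesis unfolding W_def openin_open by blast
  qed
  show "\<exists>\<V>. finite \<V> \<and> (\<forall>V\<in>\<V>. openin (top_of_set X) V) \<and> X \<subseteq> \<Union>\<V> \<and>
     (\<forall>V\<in>\<V>. \<exists>U\<in>\<U>. V \<subseteq> U) \<and> (\<forall>x\<in>X. card {V \<in> \<V>. x \<in> V} \<le> k + 1)"
  proof (intro exI[of _ "W ` \<F>"] conjI ballI)
    show "finite (W ` \<F>)" using F(1) by simp
    show "openin (top_of_set X) V" if "V \<in> W ` \<F>" for V using that Wop by blast
    show "X \<subseteq> \<Union>(W ` \<F>)" 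
    proof
      fix x assume "x \<in> X"
      then obtain F where "F \<in> \<F>" "x \<in> F" using F(4) by blast
      then show "x \<in> \<Union>(W ` \<F>)" using \<open>x \<in> X\<close> \<eta>(1) by (auto simp: W_def intro!: bexI[of _ F])
    qed
    show "\<exists>U\<in>\<U>. V \<subseteq> U" if "V \<in> W ` \<F>" for V
    proof -
      obtain F where FF: "F \<in> \<F>" "V = W F" using \<open>V \<in> W ` \<F>\<close> by blast
      then obtain a where a: "a \<in> F" "a \<in> X" using F(3) by blast
      then obtain U where U: "U \<in> \<U>" "ball a \<epsilon> \<subseteq> G U" using \<epsilon>(2) by blast
      have "V \<subseteq> U"
      proof
        fix y assume "y \<in> V"
        then have y: "y \<in> X" "infdist y F < \<eta>" unfolding FF W_def by auto
        have "F \<noteq> {}" using a by blast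
        then obtain b where b: "b \<in> F" "dist y b < \<eta>"
          using y(2) by (auto simp: infdist_def cInf_less_iff split: if_splits)
        have "dist a b < \<epsilon> / 2" using F0(3)[of F a b] FF(1) a b unfolding \<F>_def by blast
        then have "dist a y < \<epsilon>" using b(2) \<eta>(2) dist_triangle2[of a y b] by (simp add: dist_commute)
        then show "y \<in> U" using U y(1) G(2)[OF U(1)] by auto
      qed
      with U(1) show ?thesis by blast
    qed
    show "card {V \<in> W ` \<F>. x \<in> V} \<le> k + 1" if x: "x \<in> X" for x
    proof -
      have "{V \<in> W ` \<F>. x \<in> V} = W ` {F \<in> \<F>. x \<in> W F}" by blast
      then have "card {V \<in> W ` \<F>. x \<in> V} \<le> card {F \<in> \<F>. x \<in> W F}"
        using F(1) card_image_le[of "{F \<in> \<F>. x \<in> W F}" W] by simp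
      also have "\<dots> \<le> k + 1"
      proof (rule ccontr)
        assume "\<not> ?thesis"
        then have "k + 2 \<le> card {F \<in> \<F>. x \<in> W F}" by simp
        then obtain J where J: "J \<subseteq> {F \<in> \<F>. x \<in> W F}" "card J = k + 2" "finite J"
          by (rule obtain_subset_with_card_n)
        then have JJ: "J \<in> \<J>" unfolding \<J>_def by blast
        have "J \<noteq> {}" using J(2) by auto
        have "(\<Sum>F\<in>J. infdist x F) < (\<Sum>F\<in>J. \<eta>)"
          by (rule sum_strict_mono[OF J(3) \<open>J \<noteq> {}\<close>]) (use J(1) in \<open>auto simp: W_def\<close>)
        also have "\<dots> = (k + 2) * \<eta>" using J(2) by simp
        also have "\<dots> \<le> \<mu> J" using \<eta>(3)[OF JJ] by (simp add: field_simps)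
        finally show False using \<mu>(2)[OF JJ x] by simp
      qed
      finally show ?thesis .
    qed
  qed
qed

subsection \<open>Freudenthal tiles\<close>

text \<open>The tiles are dual to the vertices of the Freudenthal triangulation:
  \<open>kuhn_weight v x\<close>, where positive, is the barycentric coordinate of \<open>x\<close> at the lattice point \<open>v\<close>.
  The points lying in the maximal number of tiles are barycentres, hence rational.\<close>

definition over_gap :: "('n::finite \<Rightarrow> int) \<Rightarrow> real^'n \<Rightarrow> real" where
  "over_gap v x = Max (insert 0 (range (\<lambda>i. x $ i - v i)))"

definition under_gap :: "('n::finite \<Rightarrow> int) \<Rightarrow> real^'n \<Rightarrow> real" where
  "under_gap v x = Max (insert 0 (range (\<lambda>i. v i - x $ i)))"

definition kuhn_weight :: "('n::finite \<Rightarrow> int) \<Rightarrow> real^'n \<Rightarrow> real" where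
  "kuhn_weight v x = 1 - over_gap v x - under_gap v x"

definition kuhn_tile :: "('n::finite \<Rightarrow> int) \<Rightarrow> (real^'n) set" where
  "kuhn_tile v = {x. \<forall>w. kuhn_weight w x \<le> kuhn_weight v x}"

lemma over_gap_ge: "0 \<le> over_gap v x" "x $ i - v i \<le> over_gap v x"
  unfolding over_gap_def by (rule Max_ge, simp, simp)+

lemma under_gap_ge: "0 \<le> under_gap v x" "v i - x $ i \<le> under_gap v x"
  unfolding under_gap_def by (rule Max_ge, simp, simp)+

lemma over_gap_cases: "over_gap v x = 0 \<or> (\<exists>i. over_gap v x = x $ i - v i)"
  using Max_in[of "insert 0 (range (\<lambda>i. x $ i - v i))"] unfolding over_gap_def by auto

lemma under_gap_cases: "under_gap v x = 0 \<or> (\<exists>i. under_gap v x = v i - x $ i)"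
  using Max_in[of "insert 0 (range (\<lambda>i. v i - x $ i))"] unfolding under_gap_def by auto

lemma kuhn_weight_le: "kuhn_weight v x \<le> 1 - \<bar>x $ i - v i\<bar>"
  using over_gap_ge(1)[of v x] under_gap_ge(1)[of v x] over_gap_ge(2)[where i=i and v=v and x=x]
    under_gap_ge(2)[where i=i and v=v and x=x]
  unfolding kuhn_weight_def by (smt (verit))

lemma continuous_kuhn_weight: "continuous_on UNIV (kuhn_weight v)"
proof -
  have "continuous_on UNIV (over_gap v)" "continuous_on UNIV (under_gap v)"
  proof -
    have lip: "\<bar>over_gap v x - over_gap v y\<bar> \<le> dist x y \<and> \<bar>under_gap v x - under_gap v y\<bar> \<le> dist x y" for x y
    proof -
      have c: "\<bar>x $ i - y $ i\<bar> \<le> dist x y" for i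
        using component_le_norm_cart[of "x - y" i] by (simp add: dist_norm)
      have o: "over_gap v x \<le> over_gap v y + dist x y" if c: "\<And>i. \<bar>x $ i - y $ i\<bar> \<le> dist x y" for x y :: "real^'a"
        using over_gap_cases[of v x]
      proof
        assume "\<exists>i. over_gap v x = x $ i - v i"
        then obtain i where "over_gap v x = x $ i - v i" by blast
        then show ?thesis using c[of i] over_gap_ge(2)[where i=i and v=v and x=y] by linarith
      qed (use over_gap_ge(1)[of v y] in simp)
      have u: "under_gap v x \<le> under_gap v y + dist x y" if c: "\<And>i. \<bar>x $ i - y $ i\<bar> \<le> dist x y" for x y :: "real^'a"
        using under_gap_cases[of v x]
      proof
        assume "\<exists>i. under_gap v x = v i - x $ i"
        then obtain i where "under_gap v x = v i - x $ i" by blast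
        then show ?thesis using c[of i] under_gap_ge(2)[where i=i and v=v and x=y] by linarith
      qed (use under_gap_ge(1)[of v y] in simp)
      have c': "\<bar>y $ i - x $ i\<bar> \<le> dist y x" for i using c[of i] by (simp add: dist_commute abs_minus_commute)
      show ?thesis using o[of x y] o[of y x] u[of x y] u[of y x] c c' by (simp add: dist_commute abs_le_iff)
    qed
    show "continuous_on UNIV (over_gap v)"
      unfolding continuous_on_iff
    proof (intro ballI allI impI)
      fix x :: "real^'a" and e :: real assume "0 < e"
      then show "\<exists>d>0. \<forall>x'\<in>UNIV. dist x' x < d \<longrightarrow> dist (over_gap v x') (over_gap v x) < e"
        using lip by (intro exI[of _ e]) (auto simp: dist_real_def intro: le_less_trans)
    qed
    show "continuous_on UNIV (under_gap v)"
      unfolding continuous_on_iff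
    proof (intro ballI allI impI)
      fix x :: "real^'a" and e :: real assume "0 < e"
      then show "\<exists>d>0. \<forall>x'\<in>UNIV. dist x' x < d \<longrightarrow> dist (under_gap v x') (under_gap v x) < e"
        using lip by (intro exI[of _ e]) (auto simp: dist_real_def intro: le_less_trans)
    qed
  qed
  then show ?thesis unfolding kuhn_weight_def by (intro continuous_intros)
qed

lemma closed_kuhn_tile: "closed (kuhn_tile v)"
proof -
  have "kuhn_tile v = (\<Inter>w. {x. kuhn_weight w x \<le> kuhn_weight v x})"
    by (auto simp: kuhn_tile_def)
  then show ?thesis
    by (auto intro!: closed_INT closed_Collect_le continuous_kuhn_weight)
qed

text \<open>Positive weight means that \<open>over_gap\<close> and \<open>under_gap\<close> add up
  to less than 1, so \<open>v i\<close> is the only integer in the half-open unit interval starting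
  at \<open>x $ i - over_gap v x\<close>. A vertex near \<open>x\<close> is thus determined by one
  number, its over gap.\<close>

lemma kuhn_vertex_unique:
  assumes "0 < kuhn_weight v x"
  shows "v i = \<lceil>x $ i - over_gap v x\<rceil>"
  using over_gap_ge(2)[where i=i and v=v and x=x] under_gap_ge(2)[where i=i and v=v and x=x] assms
  unfolding kuhn_weight_def by (intro ceiling_unique[symmetric]) linarith+

text \<open>The candidates for the over gap of a vertex with positive weight; their number is
  bounded by the number of vertices of a simplex.\<close>

definition frac_values :: "real^'n::finite \<Rightarrow> real set" where
  "frac_values x = insert 0 (range (\<lambda>i. frac (x $ i)))"

lemma card_frac_values: "finite (frac_values (x :: real^'n))" "card (frac_values (x :: real^'n)) \<le> CARD('n) + 1"
proof -
  have "card (range (\<lambda>i. frac (x $ i))) \<le> CARD('n)" by (rule card_image_le) simp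
  then show "card (frac_values x) \<le> CARD('n) + 1"
    unfolding frac_values_def using card_insert_le_m1[of "CARD('n) + 1" "range (\<lambda>i. frac (x $ i))" 0]
    by simp
qed (simp add: frac_values_def)

lemma frac_eqI: "0 \<le> r \<Longrightarrow> r < 1 \<Longrightarrow> r = x - of_int n \<Longrightarrow> frac x = r"
  for x r :: real
  by (simp add: frac_unique_iff)

lemma over_gap_in_frac_values:
  assumes "0 < kuhn_weight v x"
  shows "over_gap v x \<in> frac_values x"
  using over_gap_cases[of v x]
proof
  assume "\<exists>i. over_gap v x = x $ i - v i"
  then obtain i where i: "over_gap v x = x $ i - v i" by blast
  have "over_gap v x < 1" using assms under_gap_ge(1)[of v x] unfolding kuhn_weight_def by linarith
  then have "frac (x $ i) = over_gap v x" using i over_gap_ge(1)[of v x] by (intro frac_eqI) auto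
  then show ?thesis unfolding frac_values_def by (metis insertCI rangeI)
qed (simp add: frac_values_def)

lemma inj_on_over_gap: "inj_on (\<lambda>v. over_gap v x) {v. 0 < kuhn_weight v x}"
proof (rule inj_onI, rule ext)
  fix v w i assume "v \<in> {v. 0 < kuhn_weight v x}" "w \<in> {v. 0 < kuhn_weight v x}" "over_gap v x = over_gap w x"
  then show "v i = w i" using kuhn_vertex_unique[of v x i] kuhn_vertex_unique[of w x i] by simp
qed

lemma finite_kuhn_support: "finite {v. 0 < kuhn_weight v x}"
  by (rule finite_imageD[OF _ inj_on_over_gap], rule finite_subset[OF _ card_frac_values(1)[of x]])
     (auto simp: over_gap_in_frac_values)

lemma ex_kuhn_weight_pos: "\<exists>v. 0 < kuhn_weight v x"
proof
  define v where "v i = \<lfloor>x $ i\<rfloor>" for i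
  have "under_gap v x = 0"
    using under_gap_cases[of v x]
  proof
    assume "\<exists>i. under_gap v x = v i - x $ i"
    then obtain i where "under_gap v x = v i - x $ i" by blast
    then show ?thesis using floor_correct[of "x $ i"] under_gap_ge(1)[of v x] unfolding v_def by linarith
  qed
  moreover have "over_gap v x < 1"
    using over_gap_cases[of v x]
  proof
    assume "\<exists>i. over_gap v x = x $ i - v i"
    then obtain i where "over_gap v x = x $ i - v i" by blast
    then show ?thesis using floor_correct[of "x $ i"] unfolding v_def by linarith
  qed simp
  ultimately show "0 < kuhn_weight v x" unfolding kuhn_weight_def by simp
qed

lemma kuhn_weight_pos_if_tile: "x \<in> kuhn_tile v \<Longrightarrow> 0 < kuhn_weight v x"
  using ex_kuhn_weight_pos[of x] unfolding kuhn_tile_def by (auto intro: less_le_trans)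

text \<open>Among the infinitely many weights at \<open>x\<close> only finitely many are positive,
  and at least one is, so a largest weight exists.\<close>

lemma ex_kuhn_tile: "\<exists>v. x \<in> kuhn_tile v"
proof -
  let ?S = "{v. 0 < kuhn_weight v x}"
  have ne: "?S \<noteq> {}" using ex_kuhn_weight_pos by blast
  have "Max ((\<lambda>v. kuhn_weight v x) ` ?S) \<in> (\<lambda>v. kuhn_weight v x) ` ?S"
    using ne finite_kuhn_support[of x] by (intro Max_in) auto
  then obtain v where v: "v \<in> ?S" "kuhn_weight v x = Max ((\<lambda>v. kuhn_weight v x) ` ?S)" by force
  have "kuhn_weight w x \<le> kuhn_weight v x" for w
  proof (cases "0 < kuhn_weight w x")
    case True
    then show ?thesis unfolding v(2) using finite_kuhn_support[of x] by (intro Max_ge) auto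
  qed (use v(1) in auto)
  then show ?thesis unfolding kuhn_tile_def by blast
qed

text \<open>If \<open>CARD('n) + 1\<close> tiles meet at \<open>x\<close>, they carry a common
  weight \<open>c\<close>, and their over gaps exhaust \<open>frac_values x\<close>. The under gap
  that goes with the over gap \<open>t\<close> is \<open>1 - t - c\<close>; as the distance of a
  coordinate to the next integer it shows that \<open>t + c\<close> is again in
  \<open>frac_values x\<close>, unless it is 1. So steps of length \<open>c\<close> lead from every
  fractional part to 1. Starting from 0 this makes \<open>c\<close> rational, and then all
  coordinates are.\<close>

lemma card_kuhn_tiles_rational:
  fixes x :: "real^'n"
  assumes "\<not> (\<forall>i. x $ i \<in> \<rat>)"
  shows "card {v. x \<in> kuhn_tile v} \<le> CARD('n)"
proof (rule ccontr)
  let ?T = "{v. x \<in> kuhn_tile v}"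
  assume "\<not> card ?T \<le> CARD('n)"
  then have big: "CARD('n) + 1 \<le> card ?T" by simp
  have sub: "?T \<subseteq> {v. 0 < kuhn_weight v x}" using kuhn_weight_pos_if_tile by blast
  have inj: "inj_on (\<lambda>v. over_gap v x) ?T" by (rule inj_on_subset[OF inj_on_over_gap sub])
  have im: "(\<lambda>v. over_gap v x) ` ?T \<subseteq> frac_values x" using over_gap_in_frac_values sub by blast
  have "card ((\<lambda>v. over_gap v x) ` ?T) = card ?T" by (rule card_image[OF inj])
  then have eq: "(\<lambda>v. over_gap v x) ` ?T = frac_values x"
    using big card_frac_values[of x] im by (intro card_subset_eq) (auto dest: card_mono[OF card_frac_values(1)[of x]])
  have "?T \<noteq> {}" using big by (metis add_is_0 card.empty le_zero_eq zero_neq_one)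
  then obtain v0 where v0: "x \<in> kuhn_tile v0" by blast
  define c where "c = kuhn_weight v0 x"
  have c0: "0 < c" unfolding c_def using kuhn_weight_pos_if_tile[OF v0] .
  have step: "t + c = 1 \<or> t + c \<in> frac_values x" if t: "t \<in> frac_values x" for t
  proof -
    obtain v where v: "x \<in> kuhn_tile v" "t = over_gap v x" using t eq by blast
    have "kuhn_weight v x = c" using v(1) v0 unfolding c_def kuhn_tile_def by (auto intro: antisym)
    then have tc: "t + c = 1 - under_gap v x" unfolding v(2) kuhn_weight_def by simp
    from under_gap_cases[of v x] show ?thesis
    proof
      assume "\<exists>i. under_gap v x = v i - x $ i"
      then obtain i where i: "under_gap v x = v i - x $ i" by blast
      show ?thesis
      proof (cases "under_gap v x = 0")
        case False
        then have pos: "0 < under_gap v x" using under_gap_ge(1)[of v x] by linarith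
        have "0 \<le> t" unfolding v(2) by (rule over_gap_ge)
        \<comment> \<open>Here \<open>v i\<close> is the integer just above \<open>x $ i\<close>, at
          a distance strictly between 0 and 1, so the floor is \<open>v i - 1\<close>.\<close>
        then have "frac (x $ i) = t + c"
          using tc pos c0 i by (intro frac_eqI[where n = "v i - 1"]) auto
        then show ?thesis unfolding frac_values_def by (metis insertCI rangeI)
      qed (use tc in simp)
    qed (use tc in simp)
  qed
  have reach: "\<exists>k::nat. t + real k * c = 1" if t: "t \<in> frac_values x" for t
  proof (rule ccontr)
    assume no: "\<nexists>k::nat. t + real k * c = 1"
    have "t + real k * c \<in> frac_values x" for k :: nat
    proof (induction k)
      case (Suc k)
      have "t + real (Suc k) * c = (t + real k * c) + c" by (simp add: algebra_simps)
      then show ?case using step[OF Suc] no by metis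
    qed (use t in simp)
    then have "range (\<lambda>k::nat. t + real k * c) \<subseteq> frac_values x" by blast
    then have "finite (range (\<lambda>k::nat. t + real k * c))" using card_frac_values(1) finite_subset by blast
    moreover have "inj (\<lambda>k::nat. t + real k * c)" using c0 by (auto simp: inj_on_def)
    ultimately show False using finite_imageD infinite_UNIV_nat by blast
  qed
  have "0 \<in> frac_values x" by (simp add: frac_values_def)
  then obtain K :: nat where "0 + real K * c = 1" using reach by blast
  then have "c = 1 / real K" by (cases "K = 0") (auto simp: field_simps)
  then have crat: "c \<in> \<rat>" by simp
  have "x $ i \<in> \<rat>" for i
  proof -
    have "frac (x $ i) \<in> frac_values x" by (simp add: frac_values_def)
    then obtain k :: nat where "frac (x $ i) + real k * c = 1" using reach by blast
    then have "x $ i = 1 - real k * c + of_int \<lfloor>x $ i\<rfloor>" unfolding frac_def by linarith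
    moreover have "1 - real k * c + of_int \<lfloor>x $ i\<rfloor> \<in> \<rat>"
      using crat by (intro Rats_add Rats_diff Rats_mult) auto
    ultimately show ?thesis by simp
  qed
  with assms show False by blast
qed

text \<open>For a fixed rational point \<open>q\<close>, the translations that bring some point of
  \<open>X\<close> onto \<open>q\<close> form a reflected copy of \<open>X\<close>, closed and
  without interior. By Baire's theorem countably many such sets do not exhaust the space.\<close>

lemma ex_translation_without_rational_points:
  fixes X :: "(real^'n) set"
  assumes "closed X" "interior X = {}"
  shows "\<exists>t. \<forall>x\<in>X. \<not> (\<forall>i. (x + t) $ i \<in> \<rat>)"
proof -
  let ?R = "range (\<lambda>f::'n \<Rightarrow> rat. (\<chi> i. of_rat (f i)) :: real^'n)"
  define H where "H q = - ((\<lambda>x. q - x) ` X)" for q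
  have "UNIV \<subseteq> closure (\<Inter>(H ` ?R))"
  proof (rule Baire)
    fix T assume "T \<in> H ` ?R"
    then obtain q where T: "T = H q" by blast
    have eq: "(\<lambda>x. q - x) ` X = (\<lambda>x. q + x) ` (uminus ` X)" by (auto simp: image_image)
    have "closed ((\<lambda>x. q - x) ` X)" unfolding eq using assms(1) by (intro closed_translation closed_negations)
    moreover have "interior ((\<lambda>x. q - x) ` X) = {}"
      unfolding eq using assms(2) by (simp add: interior_translation interior_negations)
    ultimately show "openin (top_of_set UNIV) T \<and> UNIV \<subseteq> closure T"
      unfolding T H_def by (simp add: closure_complement open_Compl)
  qed auto
  then have "\<Inter>(H ` ?R) \<noteq> {}" using closure_empty by force
  then obtain t where t: "t \<in> \<Inter>(H ` ?R)" by blast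
  have False if x: "x \<in> X" "\<forall>i. (x + t) $ i \<in> \<rat>" for x
  proof -
    have "\<forall>i. \<exists>r. (x + t) $ i = of_rat r" using x(2) by (metis Rats_cases)
    then obtain f where "\<And>i. (x + t) $ i = of_rat (f i)" by metis
    then have e: "x + t = (\<chi> i. of_rat (f i))" by (simp add: vec_eq_iff)
    then have "x + t \<in> ?R" by blast
    then have "t \<in> H (x + t)" using t by blast
    moreover have "t = (x + t) - x" by simp
    ultimately show False using x(1) unfolding H_def by blast
  qed
  then show ?thesis by blast
qed

lemma covering_dim_le_empty_interior:
  fixes X :: "(real^'n) set"
  assumes "compact X" "interior X = {}"
  shows "covering_dim_le X (CARD('n) - 1)"
proof (rule covering_dim_le_closed_covers[OF assms(1)])
  fix \<epsilon> :: real assume \<epsilon>: "0 < \<epsilon>"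
  obtain t where t: "\<forall>x\<in>X. \<not> (\<forall>i. (x + t) $ i \<in> \<rat>)"
    using ex_translation_without_rational_points[OF compact_imp_closed[OF assms(1)] assms(2)] ..
  \<comment> \<open>In the scaled picture a point of a tile differs from \<open>v\<close> by less
    than 1 in every coordinate, so summing over the coordinates bounds the diameter of a tile by
    \<open>2 * CARD('n) / M\<close>.\<close>
  obtain M :: nat where M: "2 * CARD('n) / \<epsilon> < M" using reals_Archimedean2 by blast
  then have M0: "0 < real M" using \<epsilon> by (smt (verit) divide_nonneg_pos of_nat_0_le_iff)
  define \<sigma> where "\<sigma> x = real M *\<^sub>R (x + t)" for x
  have cont: "continuous_on UNIV \<sigma>" unfolding \<sigma>_def by (intro continuous_intros)
  define tile where "tile v = \<sigma> -` kuhn_tile v" for v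
  have clo: "closed (tile v)" for v
    unfolding tile_def using closed_vimage[OF closed_kuhn_tile cont] by simp
  have near: "\<bar>real M * (x + t) $ i - v i\<bar> < 1" if "x \<in> tile v" for x v i
    using kuhn_weight_pos_if_tile[of "\<sigma> x" v] kuhn_weight_le[of v "\<sigma> x" i] that
    unfolding tile_def \<sigma>_def by (auto simp: algebra_simps)
  have small: "dist x y < \<epsilon>" if "x \<in> tile v" "y \<in> tile v" for x y v
  proof -
    have "\<bar>(x - y) $ i\<bar> \<le> 2 / M" for i
    proof -
      have "\<bar>real M * (x - y) $ i\<bar> \<le> 2"
        using near[OF that(1), of i] near[OF that(2), of i] by (simp add: algebra_simps)
      then have "real M * \<bar>(x - y) $ i\<bar> \<le> 2" by (simp only: abs_mult abs_of_nat)
      then show ?thesis using M0 by (simp only: pos_le_divide_eq mult.commute)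
    qed
    then have "norm (x - y) \<le> (\<Sum>i\<in>(UNIV::'n set). 2 / M)"
      by (intro order_trans[OF norm_le_l1_cart] sum_mono) 
    also have "\<dots> = 2 * CARD('n) / M" by simp
    also have "\<dots> < \<epsilon>" using M M0 \<epsilon> by (simp add: field_simps)
    finally show ?thesis by (simp add: dist_norm)
  qed
  define I where "I = {v. tile v \<inter> X \<noteq> {}}"
  have finI: "finite I"
  proof -
    obtain b where b: "\<And>x. x \<in> X \<Longrightarrow> norm x \<le> b"
      using compact_imp_bounded[OF assms(1)] by (auto simp: bounded_iff)
    define N where "N = \<lceil>real M * (b + norm t) + 1\<rceil>"
    have "I \<subseteq> {v. \<forall>i. v i \<in> {-N..N}}"
    proof (clarsimp simp: I_def)
      fix v i assume "tile v \<inter> X \<noteq> {}"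
      then obtain x where x: "x \<in> tile v" "x \<in> X" by blast
      have "\<bar>(x + t) $ i\<bar> \<le> norm (x + t)" by (rule component_le_norm_cart)
      also have "\<dots> \<le> b + norm t" using b[OF x(2)] norm_triangle_ineq[of x t] by linarith
      finally have "\<bar>real M * (x + t) $ i\<bar> \<le> real M * (b + norm t)"
        using M0 by (simp add: abs_mult mult_left_mono)
      then have "\<bar>real_of_int (v i)\<bar> \<le> real M * (b + norm t) + 1"
        using near[OF x(1), of i] by linarith
      then have "\<bar>real_of_int (v i)\<bar> \<le> real_of_int N" unfolding N_def by linarith
      then show "- N \<le> v i \<and> v i \<le> N" by linarith
    qed
    moreover have "finite {v::'n \<Rightarrow> int. \<forall>i. v i \<in> {-N..N}}"
      using finite_PiE[of "UNIV::'n set" "\<lambda>_. {-N..N}"] by (simp add: PiE_UNIV_domain Pi_def)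
    ultimately show ?thesis using finite_subset by blast
  qed
  show "\<exists>\<F>. finite \<F> \<and> (\<forall>F\<in>\<F>. closed F \<and> (\<forall>x\<in>F. \<forall>y\<in>F. dist x y < \<epsilon>)) \<and>
        X \<subseteq> \<Union>\<F> \<and> (\<forall>x\<in>X. card {F\<in>\<F>. x \<in> F} \<le> CARD('n) - 1 + 1)"
  proof (intro exI[of _ "tile ` I"] conjI ballI)
    show "finite (tile ` I)" using finI by simp
    show "closed F" if "F \<in> tile ` I" for F using that clo by blast
    show "dist x y < \<epsilon>" if "F \<in> tile ` I" "x \<in> F" "y \<in> F" for F x y using that small by blast
    show "X \<subseteq> \<Union>(tile ` I)"
    proof
      fix x assume x: "x \<in> X"
      obtain v where "\<sigma> x \<in> kuhn_tile v" using ex_kuhn_tile by blast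
      then have "x \<in> tile v" by (simp add: tile_def)
      with x show "x \<in> \<Union>(tile ` I)" unfolding I_def by blast
    qed
    show "card {F \<in> tile ` I. x \<in> F} \<le> CARD('n) - 1 + 1" if x: "x \<in> X" for x
    proof -
      \<comment> \<open>The scale \<open>M\<close> is an integer, so \<open>\<sigma> x\<close> is
        rational only if \<open>x + t\<close> is.\<close>
      have irr: "\<not> (\<forall>i. \<sigma> x $ i \<in> \<rat>)"
      proof
        assume r: "\<forall>i. \<sigma> x $ i \<in> \<rat>"
        have "(x + t) $ i \<in> \<rat>" for i
        proof -
          have "(x + t) $ i = \<sigma> x $ i / real M" using M0 by (simp add: \<sigma>_def)
          then show ?thesis using r by simp
        qed
        with t x show False by blast
      qed
      have fin: "finite {v. \<sigma> x \<in> kuhn_tile v}"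
        by (rule finite_subset[OF _ finite_kuhn_support[of "\<sigma> x"]]) (use kuhn_weight_pos_if_tile in blast)
      have "{F \<in> tile ` I. x \<in> F} \<subseteq> tile ` {v. \<sigma> x \<in> kuhn_tile v}" by (auto simp: tile_def)
      then have "card {F \<in> tile ` I. x \<in> F} \<le> card {v. \<sigma> x \<in> kuhn_tile v}"
        using surj_card_le[OF fin] by blast
      also have "\<dots> \<le> CARD('n)" by (rule card_kuhn_tiles_rational[OF irr])
      finally show ?thesis by simp
    qed
  qed
qed

section \<open>Layered spaces\<close>

text \<open>The \<alpha> of the overview. The divisor 4 makes it at most 1/4 on
  \<open>cball 0 2\<close>. The \<beta> in \<open>layer_factor\<close> is at most 3/16 there,
  because points of that ball are within 3 of every point of the unit ball. The sum stays below
  1/2.\<close>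

definition rim_gap :: "'a::real_normed_vector \<Rightarrow> real" where
  "rim_gap x = max 0 (norm x - 1) / 4"

text \<open>Coefficients of \<alpha> and \<beta> in the three layers of a group. Without
  \<open>(0, 1)\<close> the layers lie above each other in a fixed order.\<close>

definition layer_idx :: "(real \<times> real) set" where
  "layer_idx = {(0, 0), (1, 0), (1, 1)}"

definition layer_factor :: "'a::real_normed_vector set \<Rightarrow> real \<times> real \<Rightarrow> 'a \<Rightarrow> real" where
  "layer_factor A w x = 1 + fst w * rim_gap x + snd w * (infdist x A / 16)"

text \<open>The limit 0 is included: the layers at this height are the base, and it makes the
  parameter space compact.\<close>

definition heights :: "real set" where
  "heights = insert 0 (range (\<lambda>m. (1/2) ^ m))"

definition layer_pt :: "'a::real_normed_vector set \<Rightarrow> 'a \<Rightarrow> real \<Rightarrow> real \<times> real \<Rightarrow> 'a \<times> real" where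
  "layer_pt A x z w = (x, (2 - norm x) * z * layer_factor A w x)"

definition layered :: "'a::real_normed_vector set \<Rightarrow> ('a \<times> real) set" where
  "layered A = (\<lambda>(x, z, w). layer_pt A x z w) ` (cball 0 2 \<times> heights \<times> layer_idx)"

definition base :: "('a::real_normed_vector \<times> real) set" where
  "base = cball 0 2 \<times> {0}"

lemma rim_gap_nonneg: "0 \<le> rim_gap x"
  by (simp add: rim_gap_def)

lemma rim_gap_eq_0_iff: "rim_gap x = 0 \<longleftrightarrow> norm x \<le> 1"
  by (auto simp: rim_gap_def)

lemma infdist_eq_0_iff_closed:
  "closed A \<Longrightarrow> infdist x A = 0 \<longleftrightarrow> A = {} \<or> x \<in> A"
  using in_closed_iff_infdist_zero[of A x] by (cases "A = {}") (simp_all add: infdist_def[of x "{}"])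

text \<open>The bound 3/2 keeps the groups apart: a height at most half of \<open>z\<close> is
  lifted to at most 3/4 of \<open>z\<close>, while the layers belonging to \<open>z\<close> start at
  \<open>z\<close>.\<close>

lemma layer_factor_bounds:
  assumes "A \<subseteq> cball 0 1" "norm x \<le> 2" "w \<in> layer_idx"
  shows "1 \<le> layer_factor A w x" "layer_factor A w x < 3/2"
proof -
  have "infdist x A \<le> 3"
  proof (cases "A = {}")
    case False
    then obtain a where a: "a \<in> A" by blast
    have "infdist x A \<le> dist x a" using a by (rule infdist_le)
    also have "\<dots> \<le> norm x + norm a" by (simp add: dist_norm norm_triangle_ineq4)
    also have "\<dots> \<le> 3" using a assms(1,2) by auto
    finally show ?thesis .
  qed (simp add: infdist_def)
  moreover have "rim_gap x \<le> 1/4" using assms(2) by (simp add: rim_gap_def)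
  ultimately show "1 \<le> layer_factor A w x" "layer_factor A w x < 3/2"
    using assms(3) rim_gap_nonneg[of x] infdist_nonneg[of x A]
    by (auto simp: layer_factor_def layer_idx_def)
qed

lemma heights_pow: "(1/2) ^ m \<in> heights" and heights_0: "0 \<in> heights"
  by (auto simp: heights_def)

lemma heights_nonneg: "z \<in> heights \<Longrightarrow> 0 \<le> z" 
  by (auto simp: heights_def)

lemma heights_gap:
  assumes "z \<in> heights" "z < (1/2) ^ m"
  shows "z \<le> (1/2) ^ m / 2"
proof -
  consider "z = 0" | n where "z = (1/2) ^ n" using assms(1) by (auto simp: heights_def)
  then show ?thesis
  proof cases
    case 2
    then have "m < n" using assms(2) by (simp add: power_strict_decreasing_iff)
    then have "(1/2::real) ^ n \<le> (1/2) ^ Suc m" by (intro power_decreasing) auto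
    then show ?thesis using 2 by simp
  qed simp
qed

lemma heights_cases:
  assumes "z \<in> heights"
  obtains "z = 0" | m where "z = (1/2) ^ m"
  using assms by (auto simp: heights_def)

lemma heights_gap_heights:
  assumes "z \<in> heights" "z' \<in> heights" "z' < z"
  shows "z' \<le> z / 2"
  using assms(1)
proof (cases rule: heights_cases)
  case 1
  then show ?thesis using assms heights_nonneg by fastforce
next
  case (2 m)
  then show ?thesis using heights_gap assms by blast
qed

lemma compact_heights: "compact heights"
  unfolding heights_def by (intro compact_sequence_with_limit LIMSEQ_realpow_zero) auto

lemma finite_layer_idx: "finite layer_idx"
  by (simp add: layer_idx_def)

lemma continuous_on_layer_pt [continuous_intros]:
  assumes "continuous_on S f" "continuous_on S g" "continuous_on S h"
  shows "continuous_on S (\<lambda>s. layer_pt A (f s) (g s) (h s))"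
  unfolding layer_pt_def layer_factor_def rim_gap_def
  by (intro continuous_intros assms) auto

lemma compact_layered: "compact (layered (A :: 'a::euclidean_space set))"
  unfolding layered_def split_def
  by (intro compact_continuous_image continuous_intros compact_Times compact_cball compact_heights
      finite_imp_compact finite_layer_idx)

lemma layer_pt_in_layered: "norm x \<le> 2 \<Longrightarrow> z \<in> heights \<Longrightarrow> w \<in> layer_idx \<Longrightarrow> layer_pt A x z w \<in> layered A"
  unfolding layered_def by force

lemma layeredE:
  assumes "p \<in> layered A"
  obtains x z w where "p = layer_pt A x z w" "norm x \<le> 2" "z \<in> heights" "w \<in> layer_idx"
  using assms unfolding layered_def by force

lemma fst_layer_pt [simp]: "fst (layer_pt A x z w) = x"
  by (simp add: layer_pt_def)

lemma base_subset_layered: "base \<subseteq> layered A"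
proof
  fix p :: "'a \<times> real" assume "p \<in> base"
  then obtain x where "p = (x, 0)" "norm x \<le> 2" by (auto simp: base_def)
  then show "p \<in> layered A"
    using layer_pt_in_layered[of x 0 "(0,0)" A] by (simp add: heights_0 layer_idx_def layer_pt_def)
qed

text \<open>The complete list of identifications made by \<open>layer_pt\<close>: over the rim, on
  the base, and between layers of one group with equal factors. Two heights differ at least by the
  factor 2, which factors between 1 and 3/2 cannot make up for.\<close>

lemma layer_pt_eq_iff:
  assumes "A \<subseteq> cball 0 1" "norm x \<le> 2" "z \<in> heights" "z' \<in> heights" "w \<in> layer_idx" "w' \<in> layer_idx"
  shows "layer_pt A x z w = layer_pt A x' z' w' \<longleftrightarrow>
    x = x' \<and> (norm x = 2 \<or> z = 0 \<and> z' = 0 \<or> z = z' \<and> layer_factor A w x = layer_factor A w' x)"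
proof -
  have aux: "z = 0 \<or> z = z'"
    if "z * layer_factor A w x = z' * layer_factor A w' x" "z' \<le> z" "z \<in> heights" "z' \<in> heights" "w \<in> layer_idx" "w' \<in> layer_idx"
    for z z' w w'
  proof (rule ccontr)
    assume no: "\<not> (z = 0 \<or> z = z')"
    then have "z' < z" "0 < z" using that heights_nonneg[of z] by auto
    then have "z' \<le> z / 2" using heights_gap_heights that by blast
    note b = layer_factor_bounds[OF assms(1,2)]
    have "z' * layer_factor A w' x \<le> z / 2 * (3/2)"
      using \<open>z' \<le> z / 2\<close> b[of w'] that heights_nonneg[of z'] \<open>0 < z\<close> by (intro mult_mono) auto
    also have "\<dots> < z" using \<open>0 < z\<close> by simp
    also have "z \<le> z * layer_factor A w x" using b(1)[OF that(5)] \<open>0 < z\<close> by (simp only: mult_le_cancel_left1) simp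
    finally show False using that by simp
  qed
  have f0: "layer_factor A w x \<noteq> 0" "layer_factor A w' x \<noteq> 0"
    using layer_factor_bounds[OF assms(1,2)] assms(5,6) by (smt (verit))+
  have eq: "z * layer_factor A w x = z' * layer_factor A w' x \<longleftrightarrow>
      z = 0 \<and> z' = 0 \<or> z = z' \<and> layer_factor A w x = layer_factor A w' x" (is "?L \<longleftrightarrow> ?R")
  proof
    assume L: ?L
    have "z = 0 \<or> z' = 0 \<or> z = z'"
      using aux[OF L _ assms(3-6)] aux[OF L[symmetric] _ assms(4,3,6,5)] linear[of z z'] by blast
    then show ?R using L f0 by auto
  qed auto
  show ?thesis
    using eq assms(2) unfolding layer_pt_def by (cases "norm x = 2") (auto simp: mult.assoc)
qed

lemma layered_off_baseE:
  assumes "p \<in> layered A - base"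
  obtains x m w where "p = layer_pt A x ((1/2) ^ m) w" "norm x < 2" "w \<in> layer_idx"
proof -
  obtain x z w where p: "p = layer_pt A x z w" "norm x \<le> 2" "z \<in> heights" "w \<in> layer_idx"
    using assms layeredE by blast
  have "snd p \<noteq> 0" using assms p by (auto simp: base_def layer_pt_def)
  then have "norm x \<noteq> 2" "z \<noteq> 0" using p by (auto simp: layer_pt_def)
  then show thesis using that p by (metis heights_cases order_less_le)
qed

lemma layer_pt_off_base:
  assumes "A \<subseteq> cball 0 1" "norm x < 2" "w \<in> layer_idx"
  shows "layer_pt A x ((1/2) ^ m) w \<in> layered A - base"
proof -
  have "0 < layer_factor A w x" using layer_factor_bounds(1)[of A x w] assms by linarith
  then show ?thesis
    using assms layer_pt_in_layered[of x "(1/2)^m" w A] heights_pow[of m] by (auto simp: base_def layer_pt_def)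
qed

subsection \<open>Homeomorphic pairs give homeomorphic layered spaces\<close>

text \<open>Since \<alpha> and \<beta> are nonnegative, the coincidences among the three layers over
  a point depend only on whether each of them vanishes there. A homeomorphism can thus respect the
  identifications without respecting distances.\<close>

lemma layer_factor_eq_transfer:
  assumes "rim_gap x = 0 \<longleftrightarrow> rim_gap y = 0" "infdist x A = 0 \<longleftrightarrow> infdist y B = 0"
    "w \<in> layer_idx" "w' \<in> layer_idx"
  shows "layer_factor A w x = layer_factor A w' x \<longleftrightarrow> layer_factor B w y = layer_factor B w' y"
  using assms rim_gap_nonneg[of x] rim_gap_nonneg[of y] infdist_nonneg[of x A] infdist_nonneg[of y B]
  unfolding layer_idx_def layer_factor_def
  by (auto simp: add_nonneg_eq_0_iff)

text \<open>Replacing \<open>x\<close> by \<open>g x\<close> in the parameters respects the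
  identifications in both directions, since \<open>g\<close> preserves the rim and the zero sets of
  \<alpha> and \<beta>. It therefore induces a bijection of the layered spaces.\<close>

lemma layered_homeomorphic:
  fixes A A' :: "'a::euclidean_space set"
  assumes A: "compact A" "A \<subseteq> cball 0 1" and A': "compact A'" "A' \<subseteq> cball 0 1"
    and g: "homeomorphism (cball 0 2) (cball 0 2) g g'" "g ` cball 0 1 = cball 0 1" "g ` A = A'"
    and rim: "\<And>x. norm x \<le> 2 \<Longrightarrow> norm (g x) = 2 \<longleftrightarrow> norm x = 2"
  shows "layered A homeomorphic layered A'"
proof -
  let ?P = "cball (0::'a) 2 \<times> heights \<times> layer_idx"
  have gim: "norm (g x) \<le> 2" if "norm x \<le> 2" for x
    using homeomorphism_image1[OF g(1)] that by force
  have inj: "inj_on g (cball 0 2)" using g(1) by (metis homeomorphism_def inj_on_inverseI)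
  have z1: "rim_gap x = 0 \<longleftrightarrow> rim_gap (g x) = 0" if "norm x \<le> 2" for x
  proof -
    have "g x \<in> g ` cball 0 1 \<longleftrightarrow> x \<in> cball 0 1"
      using that by (intro inj_on_image_mem_iff[OF inj]) auto
    then show ?thesis unfolding g(2) rim_gap_eq_0_iff by simp
  qed
  have z2: "infdist x A = 0 \<longleftrightarrow> infdist (g x) A' = 0" if "norm x \<le> 2" for x
  proof -
    have "A \<subseteq> cball 0 2" using A(2) by (auto intro: order_trans)
    then have "g x \<in> g ` A \<longleftrightarrow> x \<in> A"
      using that by (intro inj_on_image_mem_iff[OF inj]) auto
    then show ?thesis using A(1) A'(1) g(3) by (auto simp: infdist_eq_0_iff_closed compact_imp_closed)
  qed
  \<comment> \<open>\<open>SOME\<close> picks one parameter triple of the point; by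
    \<open>iff\<close> below the result does not depend on the choice.\<close>
  define k where "k p = (let (x, z, w) = (SOME q. q \<in> ?P \<and> p = (\<lambda>(x, z, w). layer_pt A x z w) q)
     in layer_pt A' (g x) z w)" for p
  have iff: "layer_pt A x z w = layer_pt A x' z' w' \<longleftrightarrow> layer_pt A' (g x) z w = layer_pt A' (g x') z' w'"
    if "(x, z, w) \<in> ?P" "(x', z', w') \<in> ?P" for x z w x' z' w'
  proof -
    have n: "norm x \<le> 2" "norm x' \<le> 2" "z \<in> heights" "z' \<in> heights" "w \<in> layer_idx" "w' \<in> layer_idx"
      using that by auto
    have "g x = g x' \<longleftrightarrow> x = x'" using inj_on_eq_iff[OF inj, of x x'] n by simp
    then show ?thesis
      unfolding layer_pt_eq_iff[OF A(2) n(1) n(3-6)] layer_pt_eq_iff[OF A'(2) gim[OF n(1)] n(3-6)]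
      using rim[OF n(1)] layer_factor_eq_transfer[OF z1[OF n(1)] z2[OF n(1)] n(5,6)] by simp
  qed
  have k: "k (layer_pt A x z w) = layer_pt A' (g x) z w" if P: "(x, z, w) \<in> ?P" for x z w
  proof -
    define q where "q = (SOME q. q \<in> ?P \<and> layer_pt A x z w = (\<lambda>(x, z, w). layer_pt A x z w) q)"
    have "q \<in> ?P \<and> layer_pt A x z w = (\<lambda>(x, z, w). layer_pt A x z w) q"
      unfolding q_def by (rule someI[of _ "(x, z, w)"]) (use P in auto)
    then obtain x' z' w' where q: "q = (x', z', w')" "(x', z', w') \<in> ?P" "layer_pt A x z w = layer_pt A x' z' w'"
      by (cases q) auto
    have "k (layer_pt A x z w) = layer_pt A' (g x') z' w'"
      unfolding k_def q_def[symmetric] q(1) by simp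
    then show ?thesis using iff[OF P q(2)] q(3) by simp
  qed
  have im: "k ` layered A = layered A'"
  proof -
    have "k ` layered A = (\<lambda>(x, z, w). layer_pt A' (g x) z w) ` ?P"
      unfolding layered_def image_image using k by (intro image_cong) auto
    also have "\<dots> = (\<lambda>(x, z, w). layer_pt A' x z w) ` (\<lambda>(x, z, w). (g x, z, w)) ` ?P"
      by (simp add: image_image split_def)
    also have "(\<lambda>(x, z, w). (g x, z, w)) ` ?P = g ` cball 0 2 \<times> heights \<times> layer_idx"
      by force
    also have "g ` cball 0 2 = cball 0 2" by (rule homeomorphism_image1[OF g(1)])
    finally show ?thesis unfolding layered_def .
  qed
  have injk: "inj_on k (layered A)"
  proof (rule inj_onI)
    fix p q assume "p \<in> layered A" "q \<in> layered A" "k p = k q"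
    then show "p = q" unfolding layered_def using iff k by fastforce
  qed
  \<comment> \<open>The parametrisation is not injective, so continuity is read off the graph, which
    is a compact image of the parameter space.\<close>
  have cont: "continuous_on (layered A) k"
  proof (rule continuous_from_closed_graph[OF compact_layered[of A']])
    show "k \<in> layered A \<rightarrow> layered A'" using im by blast
    have "(\<lambda>p. (p, k p)) ` layered A = (\<lambda>(x, z, w). (layer_pt A x z w, layer_pt A' (g x) z w)) ` ?P"
      unfolding layered_def image_image using k by (intro image_cong) auto
    moreover have "continuous_on ?P (\<lambda>p. g (fst p))"
      using homeomorphism_cont1[OF g(1)] by (rule continuous_on_compose2) (auto intro!: continuous_intros)
    then have "compact ((\<lambda>(x, z, w). (layer_pt A x z w, layer_pt A' (g x) z w)) ` ?P)"
      unfolding split_def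
      by (intro compact_continuous_image continuous_intros compact_Times compact_cball compact_heights
          finite_imp_compact finite_layer_idx)
    ultimately show "closed ((\<lambda>p. (p, k p)) ` layered A)" by (simp add: compact_imp_closed)
  qed
  show ?thesis
    by (rule homeomorphic_compact[OF compact_layered cont im injk])
qed

section \<open>Extending homeomorphisms from the unit ball to the ball of radius 2\<close>

lemma homeomorphism_cball_sphere:
  fixes g :: "'a::euclidean_space \<Rightarrow> 'a"
  assumes "homeomorphism (cball 0 1) (cball 0 1) g g'" "norm x = 1"
  shows "norm (g x) = 1"
proof -
  \<comment> \<open>Invariance of domain makes the image of the open ball open, hence contained in
    the interior of \<open>cball 0 1\<close>. Applied to the inverse, this keeps sphere points from
    being mapped inside.\<close>
  have *: "norm (f x) < 1" if "homeomorphism (cball 0 1) (cball 0 1) f f'" "norm x < 1" for f f' :: "'a \<Rightarrow> 'a" and x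
  proof -
    have "inj_on f (cball 0 1)" using that(1) by (metis homeomorphism_def inj_on_inverseI)
    then have "open (f ` ball 0 1)"
      using homeomorphism_cont1[OF that(1)]
      by (meson ball_subset_cball continuous_on_subset inj_on_subset invariance_of_domain open_ball)
    moreover have "f ` ball 0 1 \<subseteq> cball 0 1" using homeomorphism_image1[OF that(1)] ball_subset_cball by blast
    ultimately have "f ` ball 0 1 \<subseteq> ball 0 1" by (metis interior_cball interior_maximal)
    then show ?thesis using that(2) by force
  qed
  have "norm (g x) \<le> 1" using homeomorphism_image1[OF assms(1)] assms(2) by force
  moreover have "g' (g x) = x" using assms homeomorphism_apply1[OF assms(1)] by simp
  ultimately show ?thesis
    using *[OF homeomorphism_symD[OF assms(1)], of "g x"] assms(2) by force
qed

text \<open>Outside the unit ball the boundary map is repeated on every concentric sphere. This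
  preserves the norm, in particular the rim where the layers collapse, and the extension of the
  inverse is the inverse of the extension.\<close>

definition radial_ext :: "('a \<Rightarrow> 'a) \<Rightarrow> 'a::real_normed_vector \<Rightarrow> 'a" where
  "radial_ext g x = (if norm x \<le> 1 then g x else norm x *\<^sub>R g (x /\<^sub>R norm x))"

lemma radial_ext_homeomorphism:
  fixes g :: "'a::euclidean_space \<Rightarrow> 'a"
  assumes "homeomorphism (cball 0 1) (cball 0 1) g g'"
  shows "homeomorphism (cball 0 2) (cball 0 2) (radial_ext g) (radial_ext g')"
    and "\<And>x. 1 \<le> norm x \<Longrightarrow> norm (radial_ext g x) = norm x"
proof -
  have norm_ext: "norm (radial_ext f x) = norm x"
    if "homeomorphism (cball 0 1) (cball 0 1) f f'" "1 \<le> norm x" for f f' :: "'a \<Rightarrow> 'a" and x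
  proof (cases "norm x = 1")
    case True
    then show ?thesis using homeomorphism_cball_sphere[OF that(1)] by (simp add: radial_ext_def)
  next
    case False
    moreover have "x \<noteq> 0" using that(2) by auto
    then have "norm (f (x /\<^sub>R norm x)) = 1"
      by (intro homeomorphism_cball_sphere[OF that(1)]) simp
    ultimately show ?thesis using that(2) by (simp add: radial_ext_def)
  qed
  have inner: "norm (f x) \<le> 1" if "homeomorphism (cball 0 1) (cball 0 1) f f'" "norm x \<le> 1"
    for f f' :: "'a \<Rightarrow> 'a" and x
    using homeomorphism_image1[OF that(1)] that(2) by force
  have cont: "continuous_on (cball 0 2) (radial_ext f)"
    if f: "homeomorphism (cball 0 1) (cball 0 1) f f'" for f f' :: "'a \<Rightarrow> 'a"
  proof -
    have "continuous_on (cball 0 1 \<union> {x \<in> cball 0 2. 1 \<le> norm x})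
      (\<lambda>x. if norm x \<le> 1 then f x else norm x *\<^sub>R f (x /\<^sub>R norm x))"
    proof (rule continuous_on_If)
      have "closed ({x::'a. 1 \<le> norm x})" by (intro closed_Collect_le continuous_intros)
      then show "closed {x::'a \<in> cball 0 2. 1 \<le> norm x}"
        using closed_Int[OF closed_cball[of "0::'a" 2] \<open>closed {x. 1 \<le> norm x}\<close>] by (simp add: Int_def)
      show "continuous_on (cball 0 1) f" by (rule homeomorphism_cont1[OF f])
      show "continuous_on {x \<in> cball 0 2. 1 \<le> norm x} (\<lambda>x. norm x *\<^sub>R f (x /\<^sub>R norm x))"
      proof (intro continuous_intros continuous_on_compose2[OF homeomorphism_cont1[OF f], of _ "\<lambda>x. x /\<^sub>R norm x"])
        show "(\<lambda>x. x /\<^sub>R norm x) ` {x \<in> cball 0 2. 1 \<le> norm x} \<subseteq> cball (0::'a) 1"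
        proof clarsimp
          fix x :: 'a assume "1 \<le> norm x"
          then have "x \<noteq> 0" by auto
          then show "inverse (norm x) * norm x \<le> 1" by simp
        qed
      qed auto
    qed auto
    moreover have "cball 0 1 \<union> {x \<in> cball 0 2. 1 \<le> norm x} = cball (0::'a) 2" by auto
    ultimately show ?thesis by (simp add: radial_ext_def[abs_def])
  qed
  have im: "radial_ext f ` cball 0 2 \<subseteq> cball 0 2" if f: "homeomorphism (cball 0 1) (cball 0 1) f f'" for f f' :: "'a \<Rightarrow> 'a"
  proof clarsimp
    fix x :: 'a assume "norm x \<le> 2"
    then show "norm (radial_ext f x) \<le> 2"
      using norm_ext[OF f, of x] inner[OF f, of x] by (cases "1 \<le> norm x") (auto simp: radial_ext_def)
  qed
  have inv: "radial_ext f' (radial_ext f x) = x"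
    if f: "homeomorphism (cball 0 1) (cball 0 1) f f'" for f f' :: "'a \<Rightarrow> 'a" and x
  proof (cases "norm x \<le> 1")
    case True
    then show ?thesis using inner[OF f True] homeomorphism_apply1[OF f, of x] by (simp add: radial_ext_def)
  next
    case False
    then have nz: "norm x \<noteq> 0" by auto
    have "radial_ext f' (radial_ext f x) = norm x *\<^sub>R f' ((norm x *\<^sub>R f (x /\<^sub>R norm x)) /\<^sub>R norm x)"
      using norm_ext[OF f, of x] False by (simp add: radial_ext_def[of f'] ) (simp add: radial_ext_def)
    also have "(norm x *\<^sub>R f (x /\<^sub>R norm x)) /\<^sub>R norm x = f (x /\<^sub>R norm x)" using nz by simp
    also have "f' (f (x /\<^sub>R norm x)) = x /\<^sub>R norm x"
      using nz by (intro homeomorphism_apply1[OF f]) simp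
    finally show ?thesis using nz by simp
  qed
  note sym = homeomorphism_symD[OF assms]
  show "homeomorphism (cball 0 2) (cball 0 2) (radial_ext g) (radial_ext g')"
    by (rule homeomorphismI) (use cont[OF assms] cont[OF sym] im[OF assms] im[OF sym] inv[OF assms] inv[OF sym] in blast)+
  show "\<And>x. 1 \<le> norm x \<Longrightarrow> norm (radial_ext g x) = norm x" by (rule norm_ext[OF assms])
qed

lemma layered_homeomorphic_if_pairs:
  fixes A :: "'a::euclidean_space set" and g :: "'a \<Rightarrow> 'a"
  assumes "compact A" "A \<subseteq> cball 0 1" and g: "homeomorphism (cball 0 1) (cball 0 1) g g'"
  shows "layered A homeomorphic layered (g ` A)"
proof (rule layered_homeomorphic[where g = "radial_ext g" and g' = "radial_ext g'"])
  have c: "continuous_on A g" using homeomorphism_cont1[OF g] assms(2) continuous_on_subset by blast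
  show "compact (g ` A)" using compact_continuous_image[OF c assms(1)] .
  show "g ` A \<subseteq> cball 0 1" using homeomorphism_image1[OF g] assms(2) by blast
  have eq: "radial_ext g x = g x" if "x \<in> cball 0 1" for x using that by (simp add: radial_ext_def)
  show "radial_ext g ` cball 0 1 = cball 0 1"
    using homeomorphism_image1[OF g] eq by (metis image_cong)
  show "radial_ext g ` A = g ` A" using eq assms(2) by (intro image_cong) auto
  show "norm (radial_ext g x) = 2 \<longleftrightarrow> norm x = 2" if "norm x \<le> 2" for x
  proof (cases "1 \<le> norm x")
    case True
    then show ?thesis using radial_ext_homeomorphism(2)[OF g] by simp
  next
    case False
    then have "norm (g x) \<le> 1" using homeomorphism_image1[OF g] by force
    then show ?thesis using False by (simp add: radial_ext_def)
  qed
qed (use assms radial_ext_homeomorphism(1)[OF g] in auto)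

subsection \<open>Two topological invariants\<close>

text \<open>A pointwise form of local connectedness, since its failure has to single out points of
  the base.\<close>

definition connected_im_kleinen :: "'a::topological_space set \<Rightarrow> 'a \<Rightarrow> bool" where
  "connected_im_kleinen X p \<longleftrightarrow>
    (\<forall>V. openin (top_of_set X) V \<and> p \<in> V \<longrightarrow>
      (\<exists>V'. openin (top_of_set X) V' \<and> p \<in> V' \<and> V' \<subseteq> V \<and> (\<forall>q\<in>V'. connected_component V p q)))"

text \<open>Near \<open>p \<in> B\<close>, every component of \<open>X - B\<close> has at most \<open>k\<close> local branches.\<close>

definition branches_le :: "'a::topological_space set \<Rightarrow> 'a set \<Rightarrow> nat \<Rightarrow> 'a \<Rightarrow> bool" where
  "branches_le X B k p \<longleftrightarrow>
    (\<forall>V. openin (top_of_set X) V \<and> p \<in> V \<longrightarrow>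
      (\<exists>V'. openin (top_of_set X) V' \<and> p \<in> V' \<and> V' \<subseteq> V \<and>
        (\<forall>S\<subseteq>V'. card S = Suc k \<and> (\<forall>q\<in>S. \<forall>r\<in>S. connected_component (X - B) q r) \<longrightarrow>
          (\<exists>q\<in>S. \<exists>r\<in>S. q \<noteq> r \<and> connected_component (V - B) q r))))"

lemma connected_component_image:
  assumes "continuous_on C h" "connected_component C p q" "h ` C \<subseteq> D"
  shows "connected_component D (h p) (h q)"
proof -
  obtain T where T: "connected T" "T \<subseteq> C" "p \<in> T" "q \<in> T"
    using assms(2) by (auto simp: connected_component_def)
  then have "connected (h ` T)" using assms(1) connected_continuous_image continuous_on_subset by blast
  then show ?thesis unfolding connected_component_def using T assms(3) by (intro exI[of _ "h ` T"]) auto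
qed

lemma connected_im_kleinen_homeomorphism:
  assumes h: "homeomorphism X Y h h'" and p: "p \<in> X" "connected_im_kleinen X p"
  shows "connected_im_kleinen Y (h p)"
  unfolding connected_im_kleinen_def
proof (intro allI impI, elim conjE)
  fix V assume V: "openin (top_of_set Y) V" "h p \<in> V"
  have VY: "V \<subseteq> Y" using V(1) openin_imp_subset by blast
  have hV: "h ` h' ` V = V" using h VY by (simp add: homeomorphism_def image_image subset_iff)
  have op: "openin (top_of_set X) (h' ` V)"
    using homeomorphism_imp_open_map[OF homeomorphism_symD[OF h] V(1)] .
  have pV: "p \<in> h' ` V" using V(2) h p(1) by (metis homeomorphism_apply1 imageI)
  obtain V' where V': "openin (top_of_set X) V'" "p \<in> V'" "V' \<subseteq> h' ` V" "\<forall>q\<in>V'. connected_component (h' ` V) p q"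
    using p(2)[unfolded connected_im_kleinen_def] op pV by blast
  have sub: "h' ` V \<subseteq> X" using op openin_imp_subset by blast
  have c: "continuous_on (h' ` V) h" using homeomorphism_cont1[OF h] sub continuous_on_subset by blast
  show "\<exists>V'. openin (top_of_set Y) V' \<and> h p \<in> V' \<and> V' \<subseteq> V \<and> (\<forall>q\<in>V'. connected_component V (h p) q)"
  proof (intro exI[of _ "h ` V'"] conjI ballI)
    show "openin (top_of_set Y) (h ` V')" using homeomorphism_imp_open_map[OF h V'(1)] .
    show "h p \<in> h ` V'" using V'(2) by blast
    show "h ` V' \<subseteq> V" using image_mono[OF V'(3), of h] hV by blast
    show "connected_component V (h p) q" if "q \<in> h ` V'" for q
    proof -
      from that obtain r where "r \<in> V'" "q = h r" by blast
      then show ?thesis using connected_component_image[OF c, of p r V] V'(4) hV by blast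
    qed
  qed
qed

lemma branches_le_homeomorphism:
  assumes h: "homeomorphism X Y h h'" and B: "B \<subseteq> X" "h ` B = B'" and p: "p \<in> X" "branches_le X B k p"
  shows "branches_le Y B' k (h p)"
  unfolding branches_le_def
proof (intro allI impI, elim conjE)
  fix V assume V: "openin (top_of_set Y) V" "h p \<in> V"
  have VY: "V \<subseteq> Y" using V(1) openin_imp_subset by blast
  have hV: "h ` h' ` V = V" using h VY by (simp add: homeomorphism_def image_image subset_iff)
  have inj: "inj_on h X" using h by (metis homeomorphism_def inj_on_inverseI)
  have inj': "inj_on h' Y" using h by (metis homeomorphism_def inj_on_inverseI)
  have op: "openin (top_of_set X) (h' ` V)"
    using homeomorphism_imp_open_map[OF homeomorphism_symD[OF h] V(1)] .
  have pV: "p \<in> h' ` V" using V(2) h p(1) by (metis homeomorphism_apply1 imageI)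
  obtain V' where V': "openin (top_of_set X) V'" "p \<in> V'" "V' \<subseteq> h' ` V"
    "\<forall>S\<subseteq>V'. card S = Suc k \<and> (\<forall>q\<in>S. \<forall>r\<in>S. connected_component (X - B) q r) \<longrightarrow>
          (\<exists>q\<in>S. \<exists>r\<in>S. q \<noteq> r \<and> connected_component (h' ` V - B) q r)"
    using p(2)[unfolded branches_le_def, rule_format, OF conjI[OF op pV]] by (elim exE conjE)
  have sub: "h' ` V \<subseteq> X" using op openin_imp_subset by blast
  have V'X: "V' \<subseteq> X" using V'(3) sub by blast
  have c: "continuous_on (h' ` V - B) h"
    by (rule continuous_on_subset[OF homeomorphism_cont1[OF h]]) (use sub in blast)
  have c': "continuous_on (Y - B') h'"
    by (rule continuous_on_subset[OF homeomorphism_cont2[OF h]]) blast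
  have "h' ` B' = B" using B h by (auto simp: homeomorphism_def image_image subset_iff)
  moreover have "B' \<subseteq> Y" using B h homeomorphism_image1 by blast
  ultimately have im': "h' ` (Y - B') = X - B"
    using inj_on_image_set_diff[OF inj', of Y B'] homeomorphism_image2[OF h] by auto
  have im: "h ` (h' ` V - B) \<subseteq> V - B'"
    using inj_on_image_set_diff[OF inj, of "h' ` V" B] sub B hV by auto
  show "\<exists>V'. openin (top_of_set Y) V' \<and> h p \<in> V' \<and> V' \<subseteq> V \<and>
        (\<forall>S\<subseteq>V'. card S = Suc k \<and> (\<forall>q\<in>S. \<forall>r\<in>S. connected_component (Y - B') q r) \<longrightarrow>
          (\<exists>q\<in>S. \<exists>r\<in>S. q \<noteq> r \<and> connected_component (V - B') q r))"
  proof (intro exI[of _ "h ` V'"] conjI allI impI)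
    show "openin (top_of_set Y) (h ` V')" using homeomorphism_imp_open_map[OF h V'(1)] .
    show "h p \<in> h ` V'" using V'(2) by blast
    show "h ` V' \<subseteq> V" using image_mono[OF V'(3), of h] hV by blast
    fix S assume S: "S \<subseteq> h ` V'" "card S = Suc k \<and> (\<forall>q\<in>S. \<forall>r\<in>S. connected_component (Y - B') q r)"
    have SY: "S \<subseteq> Y" using S(1) V'X homeomorphism_image1[OF h] by blast
    have hh: "h (h' q) = q" if "q \<in> S" for q using h that SY by (auto simp: homeomorphism_def)
    have "h' ` h ` V' = V'" using h V'X by (simp add: homeomorphism_def image_image subset_iff)
    then have 1: "h' ` S \<subseteq> V'" using image_mono[OF S(1), of h'] by simp
    have 2: "card (h' ` S) = Suc k" using S(2) card_image[OF inj_on_subset[OF inj' SY]] by simp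
    have 3: "connected_component (X - B) (h' q) (h' r)" if "q \<in> S" "r \<in> S" for q r
      using connected_component_image[OF c', of q r "X - B"] S(2) that im' by blast
    have "\<exists>q\<in>h' ` S. \<exists>r\<in>h' ` S. q \<noteq> r \<and> connected_component (h' ` V - B) q r"
      using V'(4)[rule_format, OF 1] 2 3 by blast
    then obtain q r where qr: "q \<in> S" "r \<in> S" "h' q \<noteq> h' r" "connected_component (h' ` V - B) (h' q) (h' r)"
      by blast
    then have "connected_component (V - B') q r"
      using connected_component_image[OF c qr(4) im] hh by simp
    then show "\<exists>q\<in>S. \<exists>r\<in>S. q \<noteq> r \<and> connected_component (V - B') q r"
      using qr(1-3) by (intro bexI[of _ q] bexI[of _ r]) auto
  qed
qed

subsection \<open>Separating and joining layers\<close>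

text \<open>Used contrapositively: for layers to be separated, a continuous function is exhibited
  that skips an interval of values.\<close>

lemma connected_no_gap:
  fixes \<phi> :: "'a::topological_space \<Rightarrow> real"
  assumes "connected T" "continuous_on T \<phi>" "q \<in> T" "r \<in> T" "\<phi> q \<le> a" "b \<le> \<phi> r" "a < b"
  shows "\<exists>t\<in>T. a < \<phi> t \<and> \<phi> t < b"
proof -
  have "connected (\<phi> ` T)" using assms(1,2) by (rule connected_continuous_image[rotated])
  then have "(a + b) / 2 \<in> \<phi> ` T"
    using connectedD_interval[of "\<phi> ` T" "\<phi> q" "\<phi> r" "(a + b) / 2"] assms by auto
  then show ?thesis using assms(7) by force
qed

text \<open>Undoes the collapse by dividing out \<open>2 - norm x\<close>. Over the open ball the
  groups then occupy the same disjoint ranges of values above every point.\<close>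

definition level :: "'a::real_normed_vector \<times> real \<Rightarrow> real" where
  "level p = snd p / (2 - norm (fst p))"

lemma level_layer_pt: "norm x < 2 \<Longrightarrow> level (layer_pt A x z w) = z * layer_factor A w x"
  by (simp add: level_def layer_pt_def)

lemma continuous_on_level: "(\<And>p. p \<in> T \<Longrightarrow> norm (fst p) < 2) \<Longrightarrow> continuous_on T level"
  unfolding level_def by (intro continuous_intros) force

text \<open>Heights below \<open>(1/2) ^ m\<close> are at most half of it and are lifted by a factor
  below 3/2; all other heights are at least \<open>(1/2) ^ m\<close> and are not lowered. The free
  strip lies directly below group \<open>m\<close>.\<close>

lemma level_gap:
  assumes "A \<subseteq> cball 0 1" "p \<in> layered A" "norm (fst p) < 2"
  shows "level p \<le> 3/4 * (1/2) ^ m \<or> (1/2) ^ m \<le> level p"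
proof -
  obtain x z w where p: "p = layer_pt A x z w" "norm x \<le> 2" "z \<in> heights" "w \<in> layer_idx"
    using assms(2) by (rule layeredE)
  then have l: "level p = z * layer_factor A w x" using assms(3) by (simp add: level_layer_pt)
  note b = layer_factor_bounds[OF assms(1) p(2,4)]
  have z: "0 \<le> z" using p(3) by (rule heights_nonneg)
  show ?thesis
  proof (cases "z < (1/2) ^ m")
    case True
    then have "z \<le> (1/2) ^ m / 2" using p(3) heights_gap by blast
    then have "z * layer_factor A w x \<le> ((1/2) ^ m / 2) * (3/2)" using b z by (intro mult_mono) auto
    then show ?thesis unfolding l by simp
  next
    case False
    then have "(1/2) ^ m * 1 \<le> z * layer_factor A w x" using b z by (intro mult_mono) auto
    then show ?thesis unfolding l by simp
  qed
qed

lemma off_base_norm: "p \<in> layered A - base \<Longrightarrow> norm (fst p) < 2"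
  by (erule layered_off_baseE) simp

text \<open>Passing to another group off the base would mean crossing a free strip. Together with
  \<open>layers_joined\<close> this identifies the groups with the components of the complement of
  the base.\<close>

lemma connected_same_level:
  assumes A: "A \<subseteq> cball 0 1" and T: "connected T" "T \<subseteq> layered A - base"
    and q: "layer_pt A x ((1/2) ^ m) w \<in> T" "norm x < 2" "w \<in> layer_idx"
    and r: "layer_pt A y ((1/2) ^ n) v \<in> T" "norm y < 2" "v \<in> layer_idx"
  shows "m = n"
proof -
  have aux: False if mn: "m < n"
    and q: "layer_pt A x ((1/2) ^ m) w \<in> T" "norm x < 2" "w \<in> layer_idx"
    and r: "layer_pt A y ((1/2) ^ n) v \<in> T" "norm y < 2" "v \<in> layer_idx" for m n x y w v
  proof -
    have "(1/2::real) ^ n \<le> (1/2) ^ Suc m" using mn by (intro power_decreasing) auto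
    then have "(1/2) ^ n * layer_factor A v y \<le> ((1/2) ^ m / 2) * (3/2)"
      using layer_factor_bounds[OF A, of y v] r by (intro mult_mono) auto
    then have 1: "level (layer_pt A y ((1/2) ^ n) v) \<le> 3/4 * (1/2) ^ m"
      using r by (simp add: level_layer_pt)
    have "(1/2) ^ m * 1 \<le> (1/2) ^ m * layer_factor A w x"
      using layer_factor_bounds[OF A, of x w] q by (intro mult_left_mono) auto
    then have 2: "(1/2) ^ m \<le> level (layer_pt A x ((1/2) ^ m) w)"
      using q by (simp add: level_layer_pt)
    have c: "continuous_on T level" using T(2) off_base_norm by (intro continuous_on_level) blast
    obtain t where t: "t \<in> T" "3/4 * (1/2) ^ m < level t" "level t < (1/2) ^ m"
      using connected_no_gap[OF T(1) c r(1) q(1) 1 2] by auto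
    then show False using level_gap[OF A, of t m] T(2) off_base_norm[of t A] by force
  qed
  show ?thesis using aux[OF _ q r] aux[OF _ r q] by (meson linorder_neqE_nat)
qed

lemma layers_apart_rim:
  assumes A: "A \<subseteq> cball 0 1" and T: "connected T" "T \<subseteq> layered A - base" "\<And>t. t \<in> T \<Longrightarrow> 0 < rim_gap (fst t)"
    and q: "layer_pt A x ((1/2) ^ m) (0, 0) \<in> T" "norm x < 2"
    and r: "layer_pt A y ((1/2) ^ m) w \<in> T" "norm y < 2" "w \<in> {(1, 0), (1, 1)}"
  shows False
proof -
  \<comment> \<open>Normalised so that in group \<open>m\<close> the lowest layer is at 0 and the
    two others are at 1 or above, wherever \<alpha> is positive.\<close>
  define \<phi> where "\<phi> p = (level p * 2 ^ m - 1) / rim_gap (fst p)" for p :: "'a \<times> real"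
  have \<phi>: "\<phi> (layer_pt A u ((1/2) ^ m) v) = (layer_factor A v u - 1) / rim_gap u" if "norm u < 2" for u v
    using that by (simp add: \<phi>_def level_layer_pt power_divide)
  have c: "continuous_on T \<phi>"
    unfolding \<phi>_def rim_gap_def
    by (intro continuous_intros continuous_on_level)
       (use T(2,3) off_base_norm in \<open>force simp: rim_gap_def\<close>)+
  have 1: "\<phi> (layer_pt A x ((1/2) ^ m) (0, 0)) \<le> 0" using q \<phi> by (simp add: layer_factor_def)
  have big: "1 \<le> \<phi> (layer_pt A u ((1/2) ^ m) v)"
    if "norm u < 2" "v \<in> {(1, 0), (1, 1)}" "0 < rim_gap u" for u v
  proof -
    have "rim_gap u \<le> layer_factor A v u - 1"
      using that(2) infdist_nonneg[of u A] by (auto simp: layer_factor_def)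
    then show ?thesis using \<phi>[OF that(1), of v] that(3) by simp
  qed
  have 2: "1 \<le> \<phi> (layer_pt A y ((1/2) ^ m) w)" using big r T(3)[OF r(1)] by simp
  obtain t where t: "t \<in> T" "0 < \<phi> t" "\<phi> t < 1"
    using connected_no_gap[OF T(1) c q(1) r(1) 1 2] by auto
  then obtain u n v where u: "t = layer_pt A u ((1/2) ^ n) v" "norm u < 2" "v \<in> layer_idx"
    using T(2) by (meson layered_off_baseE subsetD)
  have "n = m"
    using connected_same_level[OF A T(1,2), of u n v x m "(0,0)"] q u t by (simp add: layer_idx_def)
  then show False
    using t u big[of u v] \<phi>[of u v] T(3)[of t] by (auto simp: layer_idx_def layer_factor_def)
qed

lemma layers_apart_set:
  assumes A: "A \<subseteq> cball 0 1" and T: "connected T" "T \<subseteq> layered A - base" "\<And>t. t \<in> T \<Longrightarrow> 0 < infdist (fst t) A"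
    and q: "layer_pt A x ((1/2) ^ m) w \<in> T" "norm x < 2" "w \<in> {(0, 0), (1, 0)}"
    and r: "layer_pt A y ((1/2) ^ m) (1, 1) \<in> T" "norm y < 2" 
  shows False
proof -
  \<comment> \<open>Subtracting \<alpha> and dividing by \<beta> puts the top layer of group
    \<open>m\<close> at 1 and the two lower ones at 0 or below.\<close>
  define \<phi> where "\<phi> p = (level p * 2 ^ m - 1 - rim_gap (fst p)) / (infdist (fst p) A / 16)" for p :: "'a \<times> real"
  have \<phi>: "\<phi> (layer_pt A u ((1/2) ^ m) v) = (layer_factor A v u - 1 - rim_gap u) / (infdist u A / 16)" if "norm u < 2" for u v
    using that by (simp add: \<phi>_def level_layer_pt power_divide)
  have c: "continuous_on T \<phi>"
    unfolding \<phi>_def rim_gap_def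
    by (intro continuous_intros continuous_on_level)
       (use T(2,3) off_base_norm in \<open>force simp: rim_gap_def\<close>)+
  have small: "\<phi> (layer_pt A u ((1/2) ^ m) v) \<le> 0"
    if "norm u < 2" "v \<in> {(0, 0), (1, 0)}" "0 < infdist u A" for u v
    using that \<phi>[OF that(1), of v] rim_gap_nonneg[of u] by (auto simp: layer_factor_def divide_nonneg_pos)
  have 1: "\<phi> (layer_pt A x ((1/2) ^ m) w) \<le> 0" using small q T(3)[OF q(1)] by simp
  have big: "1 \<le> \<phi> (layer_pt A u ((1/2) ^ m) (1, 1))" if "norm u < 2" "0 < infdist u A" for u
    using that \<phi>[OF that(1), of "(1,1)"] by (simp add: layer_factor_def)
  have 2: "1 \<le> \<phi> (layer_pt A y ((1/2) ^ m) (1, 1))" using big r T(3)[OF r(1)] by simp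
  obtain t where t: "t \<in> T" "0 < \<phi> t" "\<phi> t < 1"
    using connected_no_gap[OF T(1) c q(1) r(1) 1 2] by auto
  then obtain u n v where u: "t = layer_pt A u ((1/2) ^ n) v" "norm u < 2" "v \<in> layer_idx"
    using T(2) by (meson layered_off_baseE subsetD)
  have "n = m"
    using connected_same_level[OF A T(1,2), of u n v y m "(1,1)"] r u t by (simp add: layer_idx_def)
  then show False
    using t u big[of u] small[of u v] T(3)[of t] by (auto simp: layer_idx_def)
qed

lemma connected_layer:
  "connected D \<Longrightarrow> connected ((\<lambda>y. layer_pt A y z w) ` D)"
  by (intro connected_continuous_image continuous_intros)

text \<open>The lower two layers of a group meet over the centre, where \<alpha> is 0, and the upper
  two over any point where \<beta> is 0. So branches that are separate near a base point still
  belong to one component of the complement.\<close>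

lemma layers_joined:
  fixes A :: "'a::euclidean_space set"
  assumes A: "A \<subseteq> cball 0 1" and x: "norm x < 2" "w \<in> layer_idx" and y: "norm y < 2" "v \<in> layer_idx"
  shows "connected_component (layered A - base) (layer_pt A x ((1/2) ^ m) w) (layer_pt A y ((1/2) ^ m) v)"
proof -
  let ?cc = "connected_component (layered A - base)"
  have same: "?cc (layer_pt A x ((1/2) ^ m) w) (layer_pt A y ((1/2) ^ m) w)"
    if "norm x < 2" "norm y < 2" "w \<in> layer_idx" for x y w
    unfolding connected_component_def
    using that layer_pt_off_base[OF A _ that(3)]
    by (intro exI[of _ "(\<lambda>y. layer_pt A y ((1/2) ^ m) w) ` ball 0 2"] conjI connected_layer) auto
  have meet: "?cc (layer_pt A x ((1/2) ^ m) w) (layer_pt A y ((1/2) ^ m) v)"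
    if "layer_factor A w a = layer_factor A v a" "norm a < 2" "w \<in> layer_idx" "v \<in> layer_idx"
      "norm x < 2" "norm y < 2" for x y w v a
  proof -
    have "layer_pt A a ((1/2) ^ m) w = layer_pt A a ((1/2) ^ m) v" using that by (simp add: layer_pt_def)
    then show ?thesis
      using connected_component_trans[of "layered A - base" "layer_pt A x ((1/2) ^ m) w" "layer_pt A a ((1/2) ^ m) w"]
        same[OF that(5,2,3)] same[OF that(2,6,4)] by simp
  qed
  \<comment> \<open>For empty \<open>A\<close> the convention for \<open>infdist\<close> makes
    \<beta> vanish everywhere, so the centre will do.\<close>
  obtain a where a: "norm a < 2" "infdist a A = 0"
  proof (cases "A = {}")
    case True
    then show thesis by (intro that[of 0]) (auto simp: infdist_def)
  next
    case False
    then obtain a where "a \<in> A" by blast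
    then show thesis using A by (intro that[of a]) force+
  qed
  have mid: "?cc (layer_pt A x ((1/2) ^ m) w) (layer_pt A 0 ((1/2) ^ m) (1, 0))"
    if "norm x < 2" "w \<in> layer_idx" for x w
  proof -
    consider "w = (0, 0)" | "w = (1, 0)" | "w = (1, 1)" using \<open>w \<in> layer_idx\<close> by (auto simp: layer_idx_def)
    then show ?thesis
    proof cases
      case 1
      then show ?thesis using that
        by (intro meet[of _ 0]) (auto simp: layer_factor_def rim_gap_def layer_idx_def)
    next
      case 2
      then show ?thesis using that same[of x 0 w] by simp
    next
      case 3
      then show ?thesis using that a
        by (intro meet[of _ a]) (auto simp: layer_factor_def layer_idx_def)
    qed
  qed
  show ?thesis by (rule connected_component_trans[OF mid[OF x] connected_component_sym[OF mid[OF y]]])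
qed

text \<open>The groups shrink to the base, so low ones enter every neighbourhood. On the rim the
  layers have collapsed, and \<open>y\<close> must be moved slightly inwards.\<close>

lemma layered_points_near_base:
  assumes A: "A \<subseteq> cball 0 1" and x: "norm x \<le> 2" and V: "openin (top_of_set (layered A)) V" "(x, 0) \<in> V"
  shows "\<exists>y m. norm y < 2 \<and> (norm x < 2 \<longrightarrow> y = x) \<and> (\<forall>w\<in>layer_idx. layer_pt A y ((1/2) ^ m) w \<in> V)"
proof -
  obtain U where U: "open U" "V = layered A \<inter> U" using V(1) by (auto simp: openin_open)
  then obtain e where e: "0 < e" "ball (x, 0) e \<subseteq> U" using V(2) by (auto simp: open_contains_ball)
  define t where "t = min 1 (e / 8)"
  have t: "0 < t" "t \<le> 1" "t \<le> e / 8" using e(1) by (auto simp: t_def)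
  define y where "y = (if norm x < 2 then x else (1 - t) *\<^sub>R x)"
  have y: "norm y < 2" "dist x y < e / 2"
  proof -
    show "norm y < 2"
    proof (cases "norm x < 2")
      case False
      then have "norm x = 2" using x by simp
      then show ?thesis using t by (simp add: y_def)
    qed (simp add: y_def)
    have "dist x y \<le> t * norm x"
      using t by (simp add: y_def dist_norm algebra_simps)
    also have "\<dots> \<le> e / 8 * 2" using t x by (intro mult_mono) auto
    also have "\<dots> < e / 2" using e(1) by simp
    finally show "dist x y < e / 2" .
  qed
  \<comment> \<open>A layer of group \<open>m\<close> has height at most
    \<open>2 * (1/2) ^ m * (3/2)\<close>, which is below \<open>e / 2\<close>; the other half of
    \<open>e\<close> is left for the distance from \<open>x\<close> to \<open>y\<close>.\<close>
  obtain m where m: "(1/2::real) ^ m < e / 6"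
    using real_arch_pow_inv[of "e / 6" "1/2"] e(1) by auto
  have "layer_pt A y ((1/2) ^ m) w \<in> V" if w: "w \<in> layer_idx" for w
  proof -
    note b = layer_factor_bounds[OF A less_imp_le[OF y(1)] w]
    have "(2 - norm y) * (1/2) ^ m * layer_factor A w y \<le> 2 * (1/2) ^ m * (3/2)"
      using b y(1) by (intro mult_mono) auto
    also have "\<dots> < e / 2" using m by simp
    finally have h: "(2 - norm y) * (1/2) ^ m * layer_factor A w y < e / 2" .
    have "0 \<le> (2 - norm y) * (1/2) ^ m * layer_factor A w y" using b y(1) by simp
    then have "dist (x, 0) (layer_pt A y ((1/2) ^ m) w) \<le> dist x y + (2 - norm y) * (1/2) ^ m * layer_factor A w y"
      unfolding layer_pt_def dist_Pair_Pair by (intro order_trans[OF sqrt_sum_squares_le_sum]) auto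
    then have "layer_pt A y ((1/2) ^ m) w \<in> U" using e(2) h y(2) by force
    then show ?thesis unfolding U(2) using y(1) w by (simp add: layer_pt_in_layered heights_pow)
  qed
  then show ?thesis using y(1) by (intro exI[of _ y] exI[of _ m]) (auto simp: y_def)
qed

lemma not_connected_im_kleinen_base:
  assumes A: "A \<subseteq> cball 0 1" and x: "norm x < 2"
  shows "\<not> connected_im_kleinen (layered A) (x, 0)"
proof
  assume cik: "connected_im_kleinen (layered A) (x, 0)"
  \<comment> \<open>Cutting off the rim forbids the detour through the points where the layers are
    glued to the base; what remains is separated by the free strips of \<open>level\<close>.\<close>
  define V where "V = layered A \<inter> (ball 0 2 \<times> UNIV)"
  have V1: "openin (top_of_set (layered A)) V" unfolding V_def by (intro openin_open_Int open_Times) auto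
  have base: "(x, 0) \<in> base" using x by (simp add: base_def)
  then have V2: "(x, 0) \<in> V" using base_subset_layered[of A] x by (auto simp: V_def)
  obtain V' where V': "openin (top_of_set (layered A)) V'" "(x, 0) \<in> V'" "V' \<subseteq> V"
      "\<forall>q\<in>V'. connected_component V (x, 0) q"
    using cik[unfolded connected_im_kleinen_def, rule_format, OF conjI[OF V1 V2]] by (elim exE conjE)
  obtain y m where "norm x < 2 \<longrightarrow> y = x" "\<forall>w\<in>layer_idx. layer_pt A y ((1/2) ^ m) w \<in> V'"
    using layered_points_near_base[OF A less_imp_le[OF x] V'(1,2)] by (elim exE conjE)
  with x have q: "layer_pt A x ((1/2) ^ m) (0, 0) \<in> V'" by (simp add: layer_idx_def)
  then obtain T where T: "connected T" "T \<subseteq> V" "(x, 0) \<in> T" "layer_pt A x ((1/2) ^ m) (0, 0) \<in> T"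
    using V'(4) by (auto simp: connected_component_def)
  have n: "norm (fst t) < 2" if "t \<in> T" for t using that T(2) by (auto simp: V_def)
  have 1: "level (x, 0) \<le> 3/4 * (1/2) ^ m" by (simp add: level_def)
  have 2: "(1/2) ^ m \<le> level (layer_pt A x ((1/2) ^ m) (0, 0))"
    using x by (simp add: level_layer_pt layer_factor_def)
  obtain t where "t \<in> T" "3/4 * (1/2) ^ m < level t" "level t < (1/2) ^ m"
    using connected_no_gap[OF T(1) continuous_on_level[OF n] T(3,4) 1 2] by auto
  then show False using level_gap[OF A, of t m] n[of t] T(2) by (force simp: V_def)
qed

text \<open>Close to \<open>p\<close> only the layers through \<open>p\<close> are seen, each the
  graph of a continuous function over a small ball. A nearby point is joined to \<open>p\<close>
  along its own layer.\<close>

lemma connected_im_kleinen_off_base: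
  fixes A :: "'a::euclidean_space set"
  assumes A: "A \<subseteq> cball 0 1" and p: "p \<in> layered A - base"
  shows "connected_im_kleinen (layered A) p"
  unfolding connected_im_kleinen_def
proof (intro allI impI, elim conjE)
  fix V assume V: "openin (top_of_set (layered A)) V" "p \<in> V"
  obtain U where U: "open U" "V = layered A \<inter> U" using V(1) by (auto simp: openin_open)
  obtain x m w0 where x: "p = layer_pt A x ((1/2) ^ m) w0" "norm x < 2" "w0 \<in> layer_idx"
    using p by (rule layered_off_baseE)
  define z where "z = (1/2::real) ^ m"
  have z: "z \<in> heights" "0 < z" by (auto simp: z_def heights_pow)
  define W where "W = {w \<in> layer_idx. layer_factor A w x = layer_factor A w0 x}"
  have pW: "layer_pt A x z w = p" if "w \<in> W" for w using that x(1) by (simp add: W_def layer_pt_def z_def)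
  have "open ((\<Inter>w\<in>W. (\<lambda>y. layer_pt A y z w) -` U) \<inter> ball 0 2)"
  proof (intro open_Int open_INT ballI open_ball)
    show "finite W" using finite_layer_idx by (simp add: W_def)
    show "open ((\<lambda>y. layer_pt A y z w) -` U)" for w
      by (rule open_vimage[OF U(1)]) (intro continuous_intros)
  qed
  moreover have "x \<in> (\<Inter>w\<in>W. (\<lambda>y. layer_pt A y z w) -` U) \<inter> ball 0 2"
    using pW V(2) U(2) x(2) by auto
  ultimately obtain r where r: "0 < r" "ball x r \<subseteq> (\<Inter>w\<in>W. (\<lambda>y. layer_pt A y z w) -` U) \<inter> ball 0 2"
    by (rule openE)
  \<comment> \<open>The union of all layers that avoid \<open>p\<close>. It is compact because a
    positive height is isolated in \<open>heights\<close>.\<close>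
  define Bad where "Bad = (\<lambda>(x, z, w). layer_pt A x z w) `
     (cball 0 2 \<times> ((heights - {z}) \<times> layer_idx \<union> {z} \<times> (layer_idx - W)))"
  have "heights - {z} = heights \<inter> ({..z / 2} \<union> {2 * z..})"
  proof -
    have "u \<noteq> z \<longleftrightarrow> u \<in> {..z / 2} \<union> {2 * z..}" if "u \<in> heights" for u
      using heights_gap_heights[OF z(1) that] heights_gap_heights[OF that z(1)] z(2) by (cases "u < z"; cases "u = z") auto
    then show ?thesis by blast
  qed
  then have "compact (heights - {z})" by (simp add: compact_Int_closed compact_heights closed_Un)
  then have "compact Bad"
    unfolding Bad_def split_def
    by (intro compact_continuous_image continuous_intros compact_Times compact_cball compact_Un)
       (auto intro: finite_imp_compact simp: finite_layer_idx)
  moreover have "p \<notin> Bad"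
  proof
    assume "p \<in> Bad"
    then obtain y u w where "p = layer_pt A y u w" "norm y \<le> 2"
      "u \<in> heights \<and> u \<noteq> z \<and> w \<in> layer_idx \<or> u = z \<and> w \<in> layer_idx - W"
      unfolding Bad_def by force
    then show False
      using layer_pt_eq_iff[OF A less_imp_le[OF x(2)] z(1) _ x(3), of u w y] x z by (auto simp: W_def z_def)
  qed
  ultimately have opBad: "open (- Bad)" and pBad: "p \<in> - Bad" by (auto simp: compact_imp_closed open_Compl)
  define V' where "V' = layered A \<inter> (U \<inter> (ball x r \<times> UNIV) \<inter> - Bad)"
  show "\<exists>V'. openin (top_of_set (layered A)) V' \<and> p \<in> V' \<and> V' \<subseteq> V \<and> (\<forall>q\<in>V'. connected_component V p q)"
  proof (intro exI[of _ V'] conjI ballI)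
    show "openin (top_of_set (layered A)) V'"
      unfolding V'_def using U(1) opBad by (intro openin_open_Int open_Int open_Times) auto
    show "p \<in> V'" using V(2) U(2) pBad r(1) x(1) by (auto simp: V'_def layer_pt_def)
    show "V' \<subseteq> V" by (auto simp: V'_def U(2))
    fix q assume q: "q \<in> V'"
    then obtain y u w where y: "q = layer_pt A y u w" "norm y \<le> 2" "u \<in> heights" "w \<in> layer_idx"
      by (auto simp: V'_def elim: layeredE)
    have "q \<notin> Bad" using q by (auto simp: V'_def)
    then have uw: "u = z" "w \<in> W" using y unfolding Bad_def by force+
    have yr: "y \<in> ball x r" using q y(1) by (auto simp: V'_def layer_pt_def)
    show "connected_component V p q"
      unfolding connected_component_def
    proof (intro exI[of _ "(\<lambda>y. layer_pt A y z w) ` ball x r"] conjI connected_layer)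
      show "connected (ball x r)" by simp
      show "(\<lambda>y. layer_pt A y z w) ` ball x r \<subseteq> V"
      proof (rule image_subsetI)
        fix v assume "v \<in> ball x r"
        then have "layer_pt A v z w \<in> U" "norm v < 2" using r(2) uw by auto
        then show "layer_pt A v z w \<in> V" using U(2) z(1) y(4) by (auto intro: layer_pt_in_layered)
      qed
      show "p \<in> (\<lambda>y. layer_pt A y z w) ` ball x r" using pW[OF uw(2)] r(1) by (metis centre_in_ball imageI)
      show "q \<in> (\<lambda>y. layer_pt A y z w) ` ball x r" using y(1) uw(1) yr by blast
    qed
  qed
qed

section \<open>Counting the branches at points of the base\<close>

lemma openin_layered_fst:
  "open O' \<Longrightarrow> openin (top_of_set (layered A)) (layered A \<inter> fst -` O')"
  by (intro openin_open_Int open_vimage continuous_intros)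

text \<open>Where \<alpha> or \<beta> stays positive, the lowest and the highest layer of a group
  are locally apart although one component contains both. Such pairs of points exist arbitrarily
  close to the base point and are two branches.\<close>

lemma branches_le_1_imp:
  fixes A :: "'a::euclidean_space set"
  assumes A: "A \<subseteq> cball 0 1" and x: "norm x \<le> 2" and br: "branches_le (layered A) base 1 (x, 0)"
  shows "rim_gap x = 0 \<and> infdist x A = 0"
proof (rule ccontr)
  assume "\<not> ?thesis"
  then have pos: "0 < rim_gap x \<or> 0 < infdist x A"
    using rim_gap_nonneg[of x] infdist_nonneg[of x A] by linarith
  define O' where "O' = {y::'a. if 0 < rim_gap x then 0 < rim_gap y else 0 < infdist y A}"
  have "open {y::'a. 0 < rim_gap y}" "open {y. 0 < infdist y A}"
    unfolding rim_gap_def by (intro open_Collect_less continuous_intros; simp)+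
  then have opO: "open O'" unfolding O'_def by (cases "0 < rim_gap x") auto
  define V where "V = layered A \<inter> fst -` O'"
  have "(x, 0) \<in> base" using x by (simp add: base_def)
  then have xV: "(x, 0) \<in> V" using base_subset_layered[of A] pos by (auto simp: V_def O'_def)
  obtain V' where V': "openin (top_of_set (layered A)) V'" "(x, 0) \<in> V'" "V' \<subseteq> V"
     "\<forall>S\<subseteq>V'. card S = Suc 1 \<and> (\<forall>q\<in>S. \<forall>r\<in>S. connected_component (layered A - base) q r) \<longrightarrow>
          (\<exists>q\<in>S. \<exists>r\<in>S. q \<noteq> r \<and> connected_component (V - base) q r)"
    using br[unfolded branches_le_def, rule_format, OF conjI[OF openin_layered_fst[OF opO, of A, folded V_def] xV]]
    by (elim exE conjE)
  obtain y m where y: "norm y < 2" "\<forall>w\<in>layer_idx. layer_pt A y ((1/2) ^ m) w \<in> V'"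
    using layered_points_near_base[OF A x V'(1,2)] by blast
  define q where "q w = layer_pt A y ((1/2) ^ m) w" for w
  have qV: "q w \<in> V' \<and> q w \<in> layered A - base" if "w \<in> layer_idx" for w
    using that y layer_pt_off_base[OF A y(1) that] by (auto simp: q_def)
  have apart: "\<not> connected_component (V - base) (q (0,0)) (q (1,1))"
  proof
    assume "connected_component (V - base) (q (0,0)) (q (1,1))"
    then obtain T where T: "connected T" "T \<subseteq> V - base" "q (0,0) \<in> T" "q (1,1) \<in> T"
      by (auto simp: connected_component_def)
    have TX: "T \<subseteq> layered A - base" and TO: "\<And>t. t \<in> T \<Longrightarrow> fst t \<in> O'" using T(2) by (auto simp: V_def)
    show False
    proof (cases "0 < rim_gap x")
      case True
      then have "\<And>t. t \<in> T \<Longrightarrow> 0 < rim_gap (fst t)" using TO by (simp add: O'_def)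
      then show False
        using layers_apart_rim[OF A T(1) TX, of y m y "(1,1)"] T(3,4) y(1) by (simp add: q_def)
    next
      case False
      then have "\<And>t. t \<in> T \<Longrightarrow> 0 < infdist (fst t) A" using TO by (simp add: O'_def)
      then show False
        using layers_apart_set[OF A T(1) TX, of y m "(0,0)" y] T(3,4) y(1) by (simp add: q_def)
    qed
  qed
  have ne: "q (0,0) \<noteq> q (1,1)"
  proof
    assume "q (0,0) = q (1,1)"
    moreover have "q (0,0) \<in> V - base" using qV[of "(0,0)"] V'(3) by (auto simp: layer_idx_def)
    ultimately show False using apart by (metis connected_component_refl)
  qed
  let ?S = "{q (0,0), q (1,1)}"
  have "?S \<subseteq> V'" using qV by (auto simp: layer_idx_def)
  moreover have "card ?S = Suc 1" using ne by simp
  moreover have "\<forall>a\<in>?S. \<forall>b\<in>?S. connected_component (layered A - base) a b"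
    using layers_joined[OF A y(1) _ y(1)] unfolding q_def layer_idx_def by blast
  ultimately have "\<exists>a\<in>?S. \<exists>b\<in>?S. a \<noteq> b \<and> connected_component (V - base) a b"
    using V'(4) by blast
  then obtain a b where ab: "a \<in> ?S" "b \<in> ?S" "a \<noteq> b" "connected_component (V - base) a b" by blast
  from ab(4) have "connected_component (V - base) b a" by (rule connected_component_sym)
  with ab show False using apart by auto
qed

text \<open>Where both \<alpha> and \<beta> are positive, the layers of a group are pairwise apart:
  \<alpha> splits off the lowest and \<beta> the highest.\<close>

lemma branches_le_2_imp:
  fixes A :: "'a::euclidean_space set"
  assumes A: "A \<subseteq> cball 0 1" and x: "norm x \<le> 2" and br: "branches_le (layered A) base 2 (x, 0)"
  shows "rim_gap x = 0 \<or> infdist x A = 0"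
proof (rule ccontr)
  assume "\<not> ?thesis"
  then have pos: "0 < rim_gap x" "0 < infdist x A"
    using rim_gap_nonneg[of x] infdist_nonneg[of x A] by linarith+
  define O' where "O' = {y::'a. 0 < rim_gap y} \<inter> {y. 0 < infdist y A}"
  have "open {y::'a. 0 < rim_gap y}" "open {y. 0 < infdist y A}"
    unfolding rim_gap_def by (intro open_Collect_less continuous_intros; simp)+
  then have opO: "open O'" unfolding O'_def by auto
  define V where "V = layered A \<inter> fst -` O'"
  have "(x, 0) \<in> base" using x by (simp add: base_def)
  then have xV: "(x, 0) \<in> V" using base_subset_layered[of A] pos by (auto simp: V_def O'_def)
  obtain V' where V': "openin (top_of_set (layered A)) V'" "(x, 0) \<in> V'" "V' \<subseteq> V"
     "\<forall>S\<subseteq>V'. card S = Suc 2 \<and> (\<forall>q\<in>S. \<forall>r\<in>S. connected_component (layered A - base) q r) \<longrightarrow>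
          (\<exists>q\<in>S. \<exists>r\<in>S. q \<noteq> r \<and> connected_component (V - base) q r)"
    using br[unfolded branches_le_def, rule_format, OF conjI[OF openin_layered_fst[OF opO, of A, folded V_def] xV]]
    by (elim exE conjE)
  obtain y m where y: "norm y < 2" "\<forall>w\<in>layer_idx. layer_pt A y ((1/2) ^ m) w \<in> V'"
    using layered_points_near_base[OF A x V'(1,2)] by blast
  define q where "q w = layer_pt A y ((1/2) ^ m) w" for w
  have qV: "q w \<in> V' \<and> q w \<in> layered A - base" if "w \<in> layer_idx" for w
    using that y layer_pt_off_base[OF A y(1) that] by (auto simp: q_def)
  have TD: "T \<subseteq> layered A - base \<and> (\<forall>t\<in>T. 0 < rim_gap (fst t) \<and> 0 < infdist (fst t) A)" if "T \<subseteq> V - base" for T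
    using that by (auto simp: V_def O'_def)
  have apart1: "\<not> connected_component (V - base) (q (0,0)) (q w)" if w: "w \<in> {(1,0), (1,1)}" for w
  proof
    assume "connected_component (V - base) (q (0,0)) (q w)"
    then obtain T where T: "connected T" "T \<subseteq> V - base" "q (0,0) \<in> T" "q w \<in> T"
      by (auto simp: connected_component_def)
    show False
      using layers_apart_rim[OF A T(1), of y m y w] TD[OF T(2)] T(3,4) y(1) w unfolding q_def by blast
  qed
  have apart2: "\<not> connected_component (V - base) (q (1,0)) (q (1,1))"
  proof
    assume "connected_component (V - base) (q (1,0)) (q (1,1))"
    then obtain T where T: "connected T" "T \<subseteq> V - base" "q (1,0) \<in> T" "q (1,1) \<in> T"
      by (auto simp: connected_component_def)
    show False
      using layers_apart_set[OF A T(1), of y m "(1,0)" y] TD[OF T(2)] T(3,4) y(1) unfolding q_def by blast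
  qed
  have refl: "connected_component (V - base) (q w) (q w)" if "w \<in> layer_idx" for w
    using qV[OF that] V'(3) by (intro connected_component_refl) auto
  have ne: "q (0,0) \<noteq> q (1,0)" "q (0,0) \<noteq> q (1,1)" "q (1,0) \<noteq> q (1,1)"
    using apart1[of "(1,0)"] apart1[of "(1,1)"] apart2 refl[of "(0,0)"] refl[of "(1,0)"]
    by (auto simp: layer_idx_def)
  let ?S = "{q (0,0), q (1,0), q (1,1)}"
  have "?S \<subseteq> V'" using qV by (auto simp: layer_idx_def)
  moreover have "card ?S = Suc 2" using ne by simp
  moreover have "\<forall>a\<in>?S. \<forall>b\<in>?S. connected_component (layered A - base) a b"
    using layers_joined[OF A y(1) _ y(1)] unfolding q_def layer_idx_def by blast
  ultimately have "\<exists>a\<in>?S. \<exists>b\<in>?S. a \<noteq> b \<and> connected_component (V - base) a b"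
    using V'(4) by blast
  then obtain a b where ab: "a \<in> ?S" "b \<in> ?S" "a \<noteq> b" "connected_component (V - base) a b" by blast
  from ab(4) have "connected_component (V - base) b a" by (rule connected_component_sym)
  with ab show False using apart1[of "(1,0)"] apart1[of "(1,1)"] apart2 by auto
qed

text \<open>Points in one component of the complement of the base lie in one group. If its layers
  have at most \<open>k\<close> different factors at \<open>x\<close>, two of \<open>k + 1\<close>
  points lie on layers that meet over \<open>x\<close>, and these two layers over a small ball form
  a connected set.\<close>

lemma branches_leI:
  fixes A :: "'a::euclidean_space set"
  assumes A: "A \<subseteq> cball 0 1" and x: "norm x < 2" and few: "card ((\<lambda>w. layer_factor A w x) ` layer_idx) \<le> k"
  shows "branches_le (layered A) base k (x, 0)"
  unfolding branches_le_def
proof (intro allI impI, elim conjE)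
  fix V assume V: "openin (top_of_set (layered A)) V" "(x, 0) \<in> V"
  obtain U where U: "open U" "V = layered A \<inter> U" using V(1) by (auto simp: openin_open)
  then obtain e where e: "0 < e" "ball (x, 0) e \<subseteq> U" using V(2) by (auto simp: open_contains_ball)
  define d where "d = 2 - norm x"
  have d: "0 < d" "d \<le> 2" using x by (auto simp: d_def)
  define r where "r = min (e / 2) (d / 2)"
  have r: "0 < r" "r \<le> e / 2" "r \<le> d / 2" using e(1) d by (auto simp: r_def)
  \<comment> \<open>A point of \<open>V'\<close> is lower than \<open>s\<close> at a place where
    \<open>2 - norm y\<close> exceeds \<open>d / 2\<close>, so the height \<open>z\<close> of its
    group is below \<open>2 * s / d = e / 6\<close>. The group then stays below
    \<open>3 * z < e / 2\<close> over the whole ball, and the connection through \<open>x\<close>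
    does not leave \<open>V\<close>.\<close>
  define s where "s = e * d / 12"
  have s: "0 < s" "s \<le> e / 2" using e(1) d by (auto simp: s_def mult_left_mono)
  have nr: "d / 2 < 2 - norm y" "norm y < 2" if "y \<in> ball x r" for y
  proof -
    have "norm y \<le> norm x + dist x y" by (metis add.commute diff_add_cancel dist_commute dist_norm norm_triangle_ineq)
    then show "d / 2 < 2 - norm y" using that r(3) by (simp add: d_def)
    then show "norm y < 2" using d(1) by simp
  qed
  have inU: "(y, t) \<in> U" if "y \<in> ball x r" "0 \<le> t" "t < e / 2" for y t
  proof -
    have "dist (x, 0) (y, t) \<le> dist x y + t"
      unfolding dist_Pair_Pair using that(2) by (intro order_trans[OF sqrt_sum_squares_le_sum]) auto
    then show ?thesis using e(2) that r(2) by force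
  qed
  define V' where "V' = layered A \<inter> (ball x r \<times> {..<s})"
  have pt_nonneg: "0 \<le> snd p" if "p \<in> layered A" for p
    using that layer_factor_bounds(1)[OF A] heights_nonneg by (force elim!: layeredE simp: layer_pt_def)
  show "\<exists>V'. openin (top_of_set (layered A)) V' \<and> (x, 0) \<in> V' \<and> V' \<subseteq> V \<and>
        (\<forall>S\<subseteq>V'. card S = Suc k \<and> (\<forall>q\<in>S. \<forall>r\<in>S. connected_component (layered A - base) q r) \<longrightarrow>
          (\<exists>q\<in>S. \<exists>r\<in>S. q \<noteq> r \<and> connected_component (V - base) q r))"
  proof (intro exI[of _ V'] conjI allI impI)
    show "openin (top_of_set (layered A)) V'"
      unfolding V'_def by (intro openin_open_Int open_Times) auto
    show "(x, 0) \<in> V'" using V(2) U(2) r(1) s(1) by (auto simp: V'_def)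
    show "V' \<subseteq> V" using inU pt_nonneg s(2) by (force simp: V'_def U(2))
    fix S assume S: "S \<subseteq> V'" "card S = Suc k \<and> (\<forall>q\<in>S. \<forall>r\<in>S. connected_component (layered A - base) q r)"
    have off: "q \<in> layered A - base" if "q \<in> S" for q
      using S(2) that connected_component_in by blast
    have "\<exists>y m w. q = layer_pt A y ((1/2) ^ m) w \<and> norm y < 2 \<and> w \<in> layer_idx" if "q \<in> S" for q
      using off[OF that] by (elim layered_off_baseE) blast
    then obtain Y M W where rep: "\<And>q. q \<in> S \<Longrightarrow> q = layer_pt A (Y q) ((1/2) ^ M q) (W q)"
        "\<And>q. q \<in> S \<Longrightarrow> norm (Y q) < 2" "\<And>q. q \<in> S \<Longrightarrow> W q \<in> layer_idx"
      by metis
    have "card ((\<lambda>q. layer_factor A (W q) x) ` S) \<le> card ((\<lambda>w. layer_factor A w x) ` layer_idx)"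
      using rep(3) by (intro card_mono) (auto simp: finite_layer_idx)
    then have "card ((\<lambda>q. layer_factor A (W q) x) ` S) < card S" using few S(2) by simp
    then have "\<not> inj_on (\<lambda>q. layer_factor A (W q) x) S" by (rule pigeonhole)
    then obtain a b where ab: "a \<in> S" "b \<in> S" "a \<noteq> b" "layer_factor A (W a) x = layer_factor A (W b) x"
      by (auto simp: inj_on_def)
    obtain T where T: "connected T" "T \<subseteq> layered A - base" "a \<in> T" "b \<in> T"
      using S(2) ab by (meson connected_component_def)
    have same: "M a = M b"
      using connected_same_level[OF A T(1,2), of "Y a" "M a" "W a" "Y b" "M b" "W b"] T(3,4)
        rep(1)[OF ab(1)] rep(1)[OF ab(2)] rep(2,3) ab by simp
    define z where "z = (1/2::real) ^ M a"
    have z: "z \<in> heights" "0 < z" by (auto simp: z_def heights_pow)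
    have aV: "a \<in> V'" "b \<in> V'" using S(1) ab by auto
    have Ya: "Y a \<in> ball x r" "Y b \<in> ball x r"
      using aV rep(1)[OF ab(1)] rep(1)[OF ab(2)] by (auto simp: V'_def layer_pt_def)
    have "(2 - norm (Y a)) * z * 1 \<le> (2 - norm (Y a)) * z * layer_factor A (W a) (Y a)"
      using layer_factor_bounds(1)[OF A, of "Y a" "W a"] rep(2,3)[OF ab(1)] z by (intro mult_left_mono) auto
    also have "\<dots> = snd a" using rep(1)[OF ab(1)] by (metis layer_pt_def snd_conv z_def)
    also have "\<dots> < s" using aV(1) by (auto simp: V'_def)
    finally have "(2 - norm (Y a)) * z < s" by simp
    moreover have "d / 2 * z \<le> (2 - norm (Y a)) * z" using nr(1)[OF Ya(1)] z(2) by simp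
    ultimately have "d / 2 * z < s" by linarith
    then have zs: "3 * z < e / 2" using d by (simp add: s_def field_simps)
    have sheet: "(\<lambda>y. layer_pt A y z w) ` ball x r \<subseteq> V - base" if w: "w \<in> layer_idx" for w
    proof (rule image_subsetI)
      fix y assume y: "y \<in> ball x r"
      note b = layer_factor_bounds[OF A less_imp_le[OF nr(2)[OF y]] w]
      have "(2 - norm y) * z * layer_factor A w y \<le> 2 * z * (3/2)"
        using b nr(2)[OF y] z by (intro mult_mono) auto
      then have "(2 - norm y) * z * layer_factor A w y < e / 2" using zs by simp
      moreover have "0 \<le> (2 - norm y) * z * layer_factor A w y" using b nr(2)[OF y] z by simp
      ultimately have "layer_pt A y z w \<in> U" unfolding layer_pt_def using inU y by blast
      then show "layer_pt A y z w \<in> V - base"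
        using layer_pt_off_base[OF A nr(2)[OF y] w, of "M a"] by (auto simp: U(2) z_def)
    qed
    let ?T = "(\<lambda>y. layer_pt A y z (W a)) ` ball x r \<union> (\<lambda>y. layer_pt A y z (W b)) ` ball x r"
    have "layer_pt A x z (W a) = layer_pt A x z (W b)" using ab(4) by (simp add: layer_pt_def)
    then have "(\<lambda>y. layer_pt A y z (W a)) ` ball x r \<inter> (\<lambda>y. layer_pt A y z (W b)) ` ball x r \<noteq> {}"
      using r(1) by (metis IntI centre_in_ball empty_iff imageI)
    then have "connected ?T" by (intro connected_Un connected_layer connected_ball)
    moreover have "?T \<subseteq> V - base" using sheet rep(3) ab by simp
    moreover have "a \<in> ?T" using rep(1)[OF ab(1)] Ya(1) unfolding z_def by blast
    moreover have "b \<in> ?T" using rep(1)[OF ab(2)] Ya(2) unfolding z_def same by blast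
    ultimately have "connected_component (V - base) a b" unfolding connected_component_def by blast
    then show "\<exists>q\<in>S. \<exists>r\<in>S. q \<noteq> r \<and> connected_component (V - base) q r" using ab by blast
  qed
qed

lemma branches_le_1I:
  fixes A :: "'a::euclidean_space set"
  assumes "A \<subseteq> cball 0 1" "norm x \<le> 1" "infdist x A = 0"
  shows "branches_le (layered A) base 1 (x, 0)"
proof (rule branches_leI)
  have "(\<lambda>w. layer_factor A w x) ` layer_idx \<subseteq> {1}"
    using assms(2,3) rim_gap_eq_0_iff[of x] by (auto simp: layer_factor_def)
  then show "card ((\<lambda>w. layer_factor A w x) ` layer_idx) \<le> 1"
    using card_mono[of "{1::real}"] by fastforce
qed (use assms in auto)

lemma branches_le_2I:
  fixes A :: "'a::euclidean_space set"
  assumes "A \<subseteq> cball 0 1" "norm x < 2" "norm x \<le> 1 \<or> infdist x A = 0"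
  shows "branches_le (layered A) base 2 (x, 0)"
proof (rule branches_leI)
  have "(\<lambda>w. layer_factor A w x) ` layer_idx \<subseteq> {1, layer_factor A (1,1) x}"
    using assms(3) rim_gap_eq_0_iff[of x] by (auto simp: layer_factor_def layer_idx_def)
  then have "card ((\<lambda>w. layer_factor A w x) ` layer_idx) \<le> card {1, layer_factor A (1,1) x}"
    by (intro card_mono) auto
  also have "\<dots> \<le> 2" by (simp add: card_insert_if)
  finally show "card ((\<lambda>w. layer_factor A w x) ` layer_idx) \<le> 2" .
qed (use assms in auto)

subsection \<open>Recovering the pair from the layered space\<close>

text \<open>Connectedness im kleinen fails at base points over the open ball and holds off the base,
  so a homeomorphism keeps the former inside the base. The points over the sphere of radius 2 follow
  by passing to closures.\<close>

lemma base_image_subset: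
  fixes A A' :: "'a::euclidean_space set"
  assumes A: "A \<subseteq> cball 0 1" "A' \<subseteq> cball 0 1" and h: "homeomorphism (layered A) (layered A') h h'"
  shows "h ` base \<subseteq> base"
proof -
  let ?B = "ball (0::'a) 2 \<times> {0::real}"
  have "h p \<in> base" if "p \<in> ?B" for p
  proof (rule ccontr)
    assume no: "h p \<notin> base"
    have pb: "p \<in> base" using that by (auto simp: base_def)
    then have pX: "p \<in> layered A" using base_subset_layered by blast
    then have "h p \<in> layered A' - base" using no homeomorphism_image1[OF h] by blast
    then have "connected_im_kleinen (layered A') (h p)" by (rule connected_im_kleinen_off_base[OF A(2)])
    then have "connected_im_kleinen (layered A) (h' (h p))"
      using \<open>h p \<in> layered A' - base\<close> by (intro connected_im_kleinen_homeomorphism[OF homeomorphism_symD[OF h]]) auto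
    moreover have "h' (h p) = p" using homeomorphism_apply1[OF h pX] .
    ultimately show False using not_connected_im_kleinen_base[OF A(1), of "fst p"] that by (cases p) auto
  qed
  then have "h ` ?B \<subseteq> base" by blast
  moreover have "closed (base :: ('a \<times> real) set)" unfolding base_def by (intro closed_Times) auto
  moreover have "closure ?B = base" by (simp add: closure_Times base_def)
  moreover have "continuous_on (closure ?B) h"
    unfolding \<open>closure ?B = base\<close> by (rule continuous_on_subset[OF homeomorphism_cont1[OF h] base_subset_layered])
  ultimately show ?thesis using image_closure_subset by metis
qed

lemma pairs_if_layered_homeomorphic:
  fixes A A' :: "'a::euclidean_space set"
  assumes "compact A" "A \<subseteq> cball 0 1" "compact A'" "A' \<subseteq> cball 0 1"
    and "layered A homeomorphic layered A'"
  shows "\<exists>g g'. homeomorphism (cball 0 1) (cball 0 1) g g' \<and> g ` A = A'"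
proof -
  obtain h h' where h: "homeomorphism (layered A) (layered A') h h'"
    using assms(5) by (auto simp: homeomorphic_def)
  \<comment> \<open>Stated for an arbitrary pair, so that it applies to \<open>h\<close> and to its
    inverse. The implications express that having at most two branches, or at most one, is
    preserved; for nonempty closed \<open>A\<close> these conditions describe
    \<open>cball 0 1\<close> and \<open>A\<close>.\<close>
  have on_base: "\<exists>g. (\<forall>x. norm x \<le> 2 \<longrightarrow> h (x, 0) = (g x, 0) \<and> norm (g x) \<le> 2) \<and> continuous_on (cball 0 2) g \<and>
      (\<forall>x. norm x < 2 \<longrightarrow> norm x \<le> 1 \<or> infdist x A = 0 \<longrightarrow> norm (g x) \<le> 1 \<or> infdist (g x) A' = 0) \<and>
      (\<forall>x. norm x \<le> 1 \<longrightarrow> infdist x A = 0 \<longrightarrow> infdist (g x) A' = 0)"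
    if A: "A \<subseteq> cball 0 1" "A' \<subseteq> cball 0 1" and h: "homeomorphism (layered A) (layered A') h h'"
    for A A' :: "'a set" and h h'
  proof -
    have hb: "h ` base \<subseteq> base" by (rule base_image_subset[OF A h])
    have "base \<subseteq> h ` base"
    proof
      fix p :: "'a \<times> real" assume p: "p \<in> base"
      then have "h' p \<in> base" using base_image_subset[OF A(2,1) homeomorphism_symD[OF h]] by blast
      moreover have "h (h' p) = p" using homeomorphism_apply2[OF h] p base_subset_layered by blast
      ultimately show "p \<in> h ` base" by (metis imageI)
    qed
    with hb have hbe: "h ` base = base" by blast
    define g where "g x = fst (h (x, 0))" for x
    have g: "h (x, 0) = (g x, 0)" "norm (g x) \<le> 2" if "norm x \<le> 2" for x
    proof -
      have "(x, 0) \<in> base" using that by (simp add: base_def)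
      then have "h (x, 0) \<in> base" using hb by blast
      then show "h (x, 0) = (g x, 0)" "norm (g x) \<le> 2" by (auto simp: g_def base_def)
    qed
    have "continuous_on (cball 0 2) (\<lambda>x. h (x, 0))"
      by (rule continuous_on_compose2[OF continuous_on_subset[OF homeomorphism_cont1[OF h] base_subset_layered]])
         (auto intro!: continuous_intros simp: base_def)
    then have cont: "continuous_on (cball 0 2) g" unfolding g_def by (intro continuous_intros)
    have br: "branches_le (layered A') base k (g x, 0)" if "norm x \<le> 2" "branches_le (layered A) base k (x, 0)" for x k
    proof -
      have "(x, 0) \<in> layered A" using base_subset_layered[of A] that(1) by (auto simp: base_def)
      then show ?thesis
        using branches_le_homeomorphism[OF h base_subset_layered hbe _ that(2)] g(1)[OF that(1)] by simp
    qed
    show ?thesis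
    proof (intro exI[of _ g] conjI allI impI)
      fix x :: 'a assume x: "norm x < 2" "norm x \<le> 1 \<or> infdist x A = 0"
      have "branches_le (layered A') base 2 (g x, 0)"
        using br[OF _ branches_le_2I[OF A(1) x]] x(1) by simp
      then show "norm (g x) \<le> 1 \<or> infdist (g x) A' = 0"
        using branches_le_2_imp[OF A(2) g(2)] x(1) by (simp add: rim_gap_eq_0_iff)
    next
      fix x :: 'a assume x: "norm x \<le> 1" "infdist x A = 0"
      have "branches_le (layered A') base 1 (g x, 0)"
        using br[OF _ branches_le_1I[OF A(1) x]] x(1) by simp
      then show "infdist (g x) A' = 0"
        using branches_le_1_imp[OF A(2) g(2)] x(1) by simp
    qed (use g cont in auto)
  qed
  obtain g where g0: "\<forall>x. norm x \<le> 2 \<longrightarrow> h (x, 0) = (g x, 0) \<and> norm (g x) \<le> 2" "continuous_on (cball 0 2) g"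
      "\<forall>x. norm x < 2 \<longrightarrow> norm x \<le> 1 \<or> infdist x A = 0 \<longrightarrow> norm (g x) \<le> 1 \<or> infdist (g x) A' = 0"
      "\<forall>x. norm x \<le> 1 \<longrightarrow> infdist x A = 0 \<longrightarrow> infdist (g x) A' = 0"
    using on_base[OF assms(2,4) h] by (elim exE conjE)
  have g: "\<And>x. norm x \<le> 2 \<Longrightarrow> h (x, 0) = (g x, 0)" "\<And>x. norm x \<le> 2 \<Longrightarrow> norm (g x) \<le> 2"
    "continuous_on (cball 0 2) g"
    "\<And>x. norm x < 2 \<Longrightarrow> norm x \<le> 1 \<or> infdist x A = 0 \<Longrightarrow> norm (g x) \<le> 1 \<or> infdist (g x) A' = 0"
    "\<And>x. norm x \<le> 1 \<Longrightarrow> infdist x A = 0 \<Longrightarrow> infdist (g x) A' = 0"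
    using g0 by blast+
  obtain g' where g'0: "\<forall>x. norm x \<le> 2 \<longrightarrow> h' (x, 0) = (g' x, 0) \<and> norm (g' x) \<le> 2" "continuous_on (cball 0 2) g'"
      "\<forall>x. norm x < 2 \<longrightarrow> norm x \<le> 1 \<or> infdist x A' = 0 \<longrightarrow> norm (g' x) \<le> 1 \<or> infdist (g' x) A = 0"
      "\<forall>x. norm x \<le> 1 \<longrightarrow> infdist x A' = 0 \<longrightarrow> infdist (g' x) A = 0"
    using on_base[OF assms(4,2) homeomorphism_symD[OF h]] by (elim exE conjE)
  have g': "\<And>x. norm x \<le> 2 \<Longrightarrow> h' (x, 0) = (g' x, 0)" "\<And>x. norm x \<le> 2 \<Longrightarrow> norm (g' x) \<le> 2"
    "continuous_on (cball 0 2) g'"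
    "\<And>x. norm x < 2 \<Longrightarrow> norm x \<le> 1 \<or> infdist x A' = 0 \<Longrightarrow> norm (g' x) \<le> 1 \<or> infdist (g' x) A = 0"
    "\<And>x. norm x \<le> 1 \<Longrightarrow> infdist x A' = 0 \<Longrightarrow> infdist (g' x) A = 0"
    using g'0 by blast+
  have inB: "(x, 0) \<in> layered B" if "norm x \<le> 2" for x and B :: "'a set"
    using base_subset_layered[of B] that by (auto simp: base_def)
  have inv1: "g' (g x) = x" if "norm x \<le> 2" for x
    using homeomorphism_apply1[OF h inB[OF that]] g(1,2)[OF that] g'(1) by simp
  have inv2: "g (g' x) = x" if "norm x \<le> 2" for x
    using homeomorphism_apply2[OF h inB[OF that]] g'(1,2)[OF that] g(1) by simp
  have closedA: "closed A" "closed A'" using assms(1,3) by (auto simp: compact_imp_closed)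
  note zero = infdist_eq_0_iff_closed[OF closedA(1)] infdist_eq_0_iff_closed[OF closedA(2)]
  \<comment> \<open>For empty \<open>A\<close> the convention \<open>infdist x {} = 0\<close> merges the upper two layers everywhere.\<close>
  have nonempty: False
    if e: "A = {}" and A': "A' \<subseteq> cball 0 1" "A' \<noteq> {}" "closed A'" and g: "continuous_on (cball 0 2) g"
      "\<And>x. norm x < 2 \<Longrightarrow> norm x \<le> 1 \<or> infdist x A = 0 \<Longrightarrow> norm (g x) \<le> 1 \<or> infdist (g x) A' = 0"
      "\<And>x. norm x \<le> 2 \<Longrightarrow> norm (g' x) \<le> 2 \<and> g (g' x) = x" for A A' :: "'a set" and g g'
  proof -
    \<comment> \<open>With \<beta> zero everywhere, all points over the open ball have at most two
      branches and are sent into the unit ball. By continuity \<open>g\<close> maps all of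
      \<open>cball 0 2\<close> there, although it is onto \<open>cball 0 2\<close>.\<close>
    have "norm (g x) \<le> 1" if "norm x < 2" for x
      using g(2)[OF that] e A'(1,2) infdist_eq_0_iff_closed[OF A'(3)] by (auto simp: infdist_def)
    then have "g ` ball 0 2 \<subseteq> cball 0 1" by auto
    then have "g ` closure (ball 0 2) \<subseteq> cball 0 1"
      using g(1) by (intro image_closure_subset) auto
    then have small: "norm (g x) \<le> 1" if "norm x \<le> 2" for x using that by (simp add: image_subset_iff)
    obtain u :: 'a where "norm u = 2" using vector_choose_size[of 2] by auto
    then show False using g(3)[of u] small[of "g' u"] by simp
  qed
  show ?thesis
  proof (cases "A = {} \<or> A' = {}")
    case True
    have "A = {} \<and> A' = {}"
    proof (rule ccontr)
      assume "\<not> (A = {} \<and> A' = {})"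
      then consider "A = {}" "A' \<noteq> {}" | "A' = {}" "A \<noteq> {}" using True by blast
      then show False
      proof cases
        case 1
        show False
          by (rule nonempty[OF 1(1) assms(4) 1(2) closedA(2) g(3) g(4), of g']) (auto simp: g'(2) inv2)
      next
        case 2
        show False
          by (rule nonempty[OF 2(1) assms(2) 2(2) closedA(1) g'(3) g'(4), of g]) (auto simp: g(2) inv1)
      qed
    qed
    then show ?thesis using homeomorphism_ident[of "cball (0::'a) 1"] by blast
  next
    case False
    have C: "norm (g x) \<le> 1" if "norm x \<le> 1" for x
      using g(4)[of x] that False assms(4) by (auto simp: zero)
    have C': "norm (g' x) \<le> 1" if "norm x \<le> 1" for x
      using g'(4)[of x] that False assms(2) by (auto simp: zero)
    have "homeomorphism (cball 0 1) (cball 0 1) g g'"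
    proof (rule homeomorphismI)
      show "continuous_on (cball 0 1) g" "continuous_on (cball 0 1) g'"
        by (rule continuous_on_subset[OF g(3)] continuous_on_subset[OF g'(3)], simp add: subset_iff)+
    qed (use C C' inv1 inv2 in auto)
    moreover have "g ` A = A'"
    proof
      show "g ` A \<subseteq> A'" using g(5) assms(2) False by (auto simp: zero)
      show "A' \<subseteq> g ` A"
      proof
        fix y assume y: "y \<in> A'"
        then have n: "norm y \<le> 1" using assms(4) by auto
        have "infdist y A' = 0" using y by simp
        then have "infdist (g' y) A = 0" using g'(5)[OF n] by blast
        then have "g' y \<in> A" using False by (simp add: zero)
        moreover have "g (g' y) = y" using inv2[of y] n by simp
        ultimately show "y \<in> g ` A" by (metis imageI)
      qed
    qed
    ultimately show ?thesis by blast
  qed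
qed

section \<open>Connectedness and vertical fibres of the layered space\<close>

lemma connected_layered: "connected (layered (A :: 'a::euclidean_space set))"
proof -
  obtain u :: 'a where u: "norm u = 2" using vector_choose_size[of 2] by auto
  have eq: "layered A = \<Union>((\<lambda>(z, w). (\<lambda>x. layer_pt A x z w) ` cball 0 2) ` (heights \<times> layer_idx))"
    unfolding layered_def by force
  show ?thesis
    unfolding eq
  proof (rule connected_Union)
    show "connected S" if "S \<in> (\<lambda>(z, w). (\<lambda>x. layer_pt A x z w) ` cball 0 2) ` (heights \<times> layer_idx)" for S
      using that by (auto intro!: connected_layer)
    have "(u, 0) \<in> (\<lambda>x. layer_pt A x z w) ` cball 0 2" for z w
      using u by (intro image_eqI[of _ _ u]) (auto simp: layer_pt_def)
    then have "(u, 0) \<in> \<Inter>((\<lambda>(z, w). (\<lambda>x. layer_pt A x z w) ` cball 0 2) ` (heights \<times> layer_idx))"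
      by (simp add: split_def)
    then show "\<Inter>((\<lambda>(z, w). (\<lambda>x. layer_pt A x z w) ` cball 0 2) ` (heights \<times> layer_idx)) \<noteq> {}"
      by blast
  qed
qed

text \<open>Serves to exclude interior points, which would put an uncountable vertical segment into
  some fibre.\<close>

lemma countable_layered_fibre: "countable {t. (x, t) \<in> layered A}"
proof -
  have "{t. (x, t) \<in> layered A} \<subseteq> (\<lambda>(z, w). (2 - norm x) * z * layer_factor A w x) ` (heights \<times> layer_idx)"
    by (auto simp: layered_def layer_pt_def)
  moreover have "countable (heights \<times> layer_idx)"
    by (intro countable_SIGMA) (auto simp: heights_def layer_idx_def)
  ultimately show ?thesis by (meson countable_image countable_subset)
qed

section \<open>The Borel reduction\<close>

subsection \<open>The hyperspace\<close>

lemma topspace_vietoris: "topspace (vietoris X) = hyperspace X"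
proof -
  have "hyperspace X = {K \<in> hyperspace X. K \<subseteq> UNIV}" by simp
  then have "hyperspace X \<in> {{K \<in> hyperspace X. K \<subseteq> U} | U. open U}" using open_UNIV by blast
  then show ?thesis unfolding vietoris_def topology_generated_by_topspace by blast
qed

lemma openin_vietoris_subset: "open U \<Longrightarrow> openin (vietoris X) {K \<in> hyperspace X. K \<subseteq> U}"
  unfolding vietoris_def by (rule topology_generated_by_Basis) blast

lemma openin_vietoris_hit: "open U \<Longrightarrow> openin (vietoris X) {K \<in> hyperspace X. K \<inter> U \<noteq> {}}"
  unfolding vietoris_def by (rule topology_generated_by_Basis) blast

lemma borel_of_top_measurable:
  assumes "continuous_map TA TB f"
  shows "f \<in> measurable (borel_of_top TA) (borel_of_top TB)"
  unfolding borel_of_top_def[of TB]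
proof (rule measurable_measure_of)
  have subA: "{U. openin TA U} \<subseteq> Pow (topspace TA)" by (auto dest: openin_subset)
  show "{U. openin TB U} \<subseteq> Pow (topspace TB)" by (auto dest: openin_subset)
  have sp: "space (borel_of_top TA) = topspace TA"
    unfolding borel_of_top_def using subA by (simp add: space_measure_of)
  show "f \<in> space (borel_of_top TA) \<rightarrow> topspace TB"
    unfolding sp using assms by (auto simp: continuous_map_def)
  fix U assume "U \<in> {U. openin TB U}"
  then have "openin TA {x \<in> topspace TA. f x \<in> U}" using assms by (auto simp: continuous_map_def)
  moreover have "f -` U \<inter> topspace TA = {x \<in> topspace TA. f x \<in> U}" by auto
  ultimately show "f -` U \<inter> space (borel_of_top TA) \<in> sets (borel_of_top TA)"
    unfolding sp unfolding borel_of_top_def using subA by (auto simp: sets_measure_of)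
qed

lemma infdist_le_infdist_plus:
  assumes "A \<noteq> {}" "\<And>a. a \<in> A \<Longrightarrow> \<exists>b\<in>B. dist a b \<le> e"
  shows "infdist x B \<le> infdist x A + e"
proof -
  have "infdist x B - e \<le> dist x a" if a: "a \<in> A" for a
  proof -
    obtain b where b: "b \<in> B" "dist a b \<le> e" using assms(2)[OF a] by blast
    have "infdist x B \<le> dist x b" using b(1) by (rule infdist_le)
    then show ?thesis using b(2) dist_triangle[of x b a] by linarith
  qed
  then have "infdist x B - e \<le> infdist x A"
    unfolding infdist_notempty[OF assms(1)] using assms(1) by (intro cINF_greatest) auto
  then show ?thesis by simp
qed

text \<open>Images of sets that are close in the Vietoris topology are close in the Hausdorff sense,
  which gives uniform closeness of their distance functions. A layered space depends on its set only
  through \<open>infdist\<close>.\<close>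

lemma vietoris_infdist_neighbourhood:
  fixes \<theta> :: "'a::topological_space \<Rightarrow> 'b::metric_space"
  assumes \<theta>: "continuous_on X \<theta>" and K0: "K0 \<in> hyperspace X" and "0 < e"
  shows "\<exists>N. openin (vietoris X) N \<and> K0 \<in> N \<and> (\<forall>K\<in>N. \<forall>x. \<bar>infdist x (\<theta> ` K) - infdist x (\<theta> ` K0)\<bar> \<le> e)"
proof (cases "K0 = {}")
  case True
  \<comment> \<open>The empty set is isolated in the Vietoris topology, so the convention
    \<open>infdist x {} = 0\<close> does not disturb continuity.\<close>
  show ?thesis
    by (rule exI[of _ "{K \<in> hyperspace X. K \<subseteq> {}}"])
       (use True K0 openin_vietoris_subset[OF open_empty, of X] \<open>0 < e\<close> in auto)
next
  case False
  have K0': "compact K0" "K0 \<subseteq> X" using K0 by (auto simp: hyperspace_def)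
  have "compact (\<theta> ` K0)" using K0' \<theta> by (meson compact_continuous_image continuous_on_subset)
  then obtain T where T: "T \<subseteq> \<theta> ` K0" "finite T" "\<theta> ` K0 \<subseteq> (\<Union>c\<in>T. ball c (e / 2))"
    by (rule compactE_image[of _ "\<theta> ` K0" "\<lambda>c. ball c (e / 2)"]) (use \<open>0 < e\<close> in auto)
  have "\<exists>G. open G \<and> X \<inter> \<theta> -` ball c (e / 2) = X \<inter> G" for c
    using continuous_openin_preimage_gen[OF \<theta> open_ball[of c "e / 2"]] by (auto simp: openin_open)
  then obtain G where G: "\<And>c. open (G c)" "\<And>c. X \<inter> \<theta> -` ball c (e / 2) = X \<inter> G c" by metis
  have Giff: "k \<in> G c \<longleftrightarrow> dist c (\<theta> k) < e / 2" if "k \<in> X" for k c using G(2)[of c] that by auto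
  \<comment> \<open>Being covered by the \<open>G c\<close> puts the image of \<open>K\<close>
    within \<open>e / 2\<close> of the net \<open>T\<close>; hitting every \<open>G c\<close> puts a
    point of that image within \<open>e / 2\<close> of each point of the net.\<close>
  define N where "N = {K \<in> hyperspace X. K \<subseteq> (\<Union>c\<in>T. G c)} \<inter> (\<Inter>c\<in>T. {K \<in> hyperspace X. K \<inter> G c \<noteq> {}})"
  have Tne: "T \<noteq> {}" using T(3) False by auto
  show ?thesis
  proof (intro exI[of _ N] conjI ballI allI)
    have "openin (vietoris X) (\<Inter>c\<in>T. {K \<in> hyperspace X. K \<inter> G c \<noteq> {}})"
      using T(2) Tne G(1) by (intro openin_INT2 openin_vietoris_hit) auto
    then show "openin (vietoris X) N"
      unfolding N_def using G(1) by (intro openin_Int openin_vietoris_subset open_UN) auto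
    have 1: "K0 \<subseteq> (\<Union>c\<in>T. G c)"
    proof
      fix k assume k: "k \<in> K0"
      then obtain c where "c \<in> T" "dist c (\<theta> k) < e / 2" using T(3) by auto
      then show "k \<in> (\<Union>c\<in>T. G c)" using Giff[of k c] k K0' by blast
    qed
    have 2: "K0 \<inter> G c \<noteq> {}" if c: "c \<in> T" for c
    proof -
      obtain k where "k \<in> K0" "c = \<theta> k" using T(1) c by blast
      then have "k \<in> G c" using Giff[of k c] K0' \<open>0 < e\<close> by auto
      then show ?thesis using \<open>k \<in> K0\<close> by blast
    qed
    show "K0 \<in> N" unfolding N_def using 1 2 K0 by simp
    fix K x assume "K \<in> N"
    then have K: "K \<subseteq> X" "K \<subseteq> (\<Union>c\<in>T. G c)" "\<And>c. c \<in> T \<Longrightarrow> K \<inter> G c \<noteq> {}"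
      unfolding N_def hyperspace_def by auto
    have Kne: "K \<noteq> {}" using K(3) Tne by blast
    have "\<exists>b\<in>\<theta> ` K0. dist a b \<le> e" if "a \<in> \<theta> ` K" for a
    proof -
      obtain k where k: "k \<in> K" "a = \<theta> k" using \<open>a \<in> \<theta> ` K\<close> by blast
      then obtain c where c: "c \<in> T" "k \<in> G c" using K(2) by blast
      then have "dist c a < e / 2" using Giff[of k c] k K(1) by auto
      then show ?thesis using T(1) c(1) \<open>0 < e\<close> by (intro bexI[of _ c]) (auto simp: dist_commute)
    qed
    then have "infdist x (\<theta> ` K0) \<le> infdist x (\<theta> ` K) + e"
      using Kne by (intro infdist_le_infdist_plus) auto
    moreover have "\<exists>b\<in>\<theta> ` K. dist a b \<le> e" if a: "a \<in> \<theta> ` K0" for a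
    proof -
      obtain c where c: "c \<in> T" "dist c a < e / 2" using T(3) a by auto
      obtain k where k: "k \<in> K" "k \<in> G c" using K(3)[OF c(1)] by blast
      then have "dist c (\<theta> k) < e / 2" using Giff[of k c] K(1) by auto
      then have "dist a (\<theta> k) < e" using c(2) by (metis dist_triangle_half_r)
      then show ?thesis using k(1) by (intro bexI[of _ "\<theta> k"]) auto
    qed
    then have "infdist x (\<theta> ` K) \<le> infdist x (\<theta> ` K0) + e"
      using False by (intro infdist_le_infdist_plus) auto
    ultimately show "\<bar>infdist x (\<theta> ` K) - infdist x (\<theta> ` K0)\<bar> \<le> e" by linarith
  qed
qed

subsection \<open>The reduction\<close>

text \<open>An affine rescaling to the unit cube of the box with sides [-2, 2] in the directions of
  the ball and [0, 4] vertically; \<open>None\<close> indexes the additional coordinate.\<close>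

definition cube_embed :: "(real^'n) \<times> real \<Rightarrow> real^('n option)" where
  "cube_embed p = (\<chi> i. case i of None \<Rightarrow> snd p / 4 | Some j \<Rightarrow> (fst p $ j + 2) / 4)"

lemma continuous_on_cube_embed: "continuous_on S cube_embed"
  unfolding cube_embed_def
proof (rule continuous_on_vec_lambda)
  fix i :: "'a option"
  show "continuous_on S (\<lambda>p. case i of None \<Rightarrow> snd p / 4 | Some j \<Rightarrow> (fst p $ j + 2) / 4)"
    by (cases i) (auto intro!: continuous_intros)
qed

lemma cube_embed_nth [simp]: "cube_embed p $ None = snd p / 4" "cube_embed p $ Some j = (fst p $ j + 2) / 4"
  by (simp_all add: cube_embed_def)

lemma inj_cube_embed: "inj cube_embed"
proof (rule injI)
  fix p q :: "(real^'n) \<times> real" assume eq: "cube_embed p = cube_embed q"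
  have "snd p = snd q" using arg_cong[OF eq, of "\<lambda>v. v $ None"] by simp
  moreover have "fst p $ j = fst q $ j" for j using arg_cong[OF eq, of "\<lambda>v. v $ Some j"] by simp
  ultimately show "p = q" by (simp add: prod_eq_iff vec_eq_iff)
qed

lemma layered_subset: "A \<subseteq> cball 0 1 \<Longrightarrow> layered A \<subseteq> cball 0 2 \<times> {0..4}"
proof
  fix p assume A: "A \<subseteq> cball 0 1" and "p \<in> layered A"
  then obtain x z w where p: "p = layer_pt A x z w" "norm x \<le> 2" "z \<in> heights" "w \<in> layer_idx"
    by (elim layeredE)
  note b = layer_factor_bounds[OF A p(2,4)]
  have z: "0 \<le> z" "z \<le> 1" using p(3) by (auto simp: heights_def power_le_one)
  have "(2 - norm x) * z * layer_factor A w x \<le> 2 * 1 * 2" using b z p(2) by (intro mult_mono) auto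
  moreover have "0 \<le> (2 - norm x) * z * layer_factor A w x" using b z p(2) by simp
  ultimately show "p \<in> cball 0 2 \<times> {0..4}" using p(1,2) by (simp add: layer_pt_def)
qed

lemma cube_embed_layered_subset:
  assumes "A \<subseteq> cball 0 1"
  shows "cube_embed ` layered A \<subseteq> unit_cube"
proof clarify
  fix x t assume "(x, t) \<in> layered A"
  then have x: "norm x \<le> 2" "0 \<le> t" "t \<le> 4" using layered_subset[OF assms] by auto
  have "\<bar>x $ j\<bar> \<le> 2" for j using component_le_norm_cart[of x j] x(1) by linarith
  then have "0 \<le> (x $ j + 2) / 4 \<and> (x $ j + 2) / 4 \<le> 1" for j by (smt (verit) divide_nonneg_pos divide_le_eq_1_pos)
  then have "0 \<le> cube_embed (x, t) $ i \<and> cube_embed (x, t) $ i \<le> 1" for i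
    using x by (cases i) auto
  then show "cube_embed (x, t) \<in> unit_cube" by (simp add: unit_cube_def)
qed

text \<open>Only the top layer of a group depends on the set, and only vertically. The divisors 16
  and 4 multiply to 64, which outweighs the remaining factors.\<close>

lemma dist_cube_embed_layer_pt:
  assumes "norm x \<le> 2" "z \<in> heights" "w \<in> layer_idx"
  shows "dist (cube_embed (layer_pt A x z w)) (cube_embed (layer_pt B x z w)) \<le> \<bar>infdist x A - infdist x B\<bar>"
proof -
  let ?c = "(2 - norm x) * z * snd w / 64"
  have "cube_embed (layer_pt A x z w) - cube_embed (layer_pt B x z w) = axis None (?c * (infdist x A - infdist x B))"
  proof (rule vec_eq_iff[THEN iffD2], rule allI)
    fix i :: "'a option"
    show "(cube_embed (layer_pt A x z w) - cube_embed (layer_pt B x z w)) $ i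
        = axis None (?c * (infdist x A - infdist x B)) $ i"
      by (cases i) (auto simp: layer_pt_def layer_factor_def axis_def field_simps)
  qed
  also have "\<dots> = (?c * (infdist x A - infdist x B)) *\<^sub>R axis None 1"
    by (simp add: vec_eq_iff axis_def)
  finally have "dist (cube_embed (layer_pt A x z w)) (cube_embed (layer_pt B x z w)) = \<bar>?c\<bar> * \<bar>infdist x A - infdist x B\<bar>"
    by (simp add: dist_norm abs_mult)
  also have "\<dots> \<le> 1 * \<bar>infdist x A - infdist x B\<bar>"
  proof (rule mult_right_mono)
    have z: "0 \<le> z" "z \<le> 1" using assms(2) by (auto simp: heights_def power_le_one)
    have "0 \<le> snd w" "snd w \<le> 1" using assms(3) by (auto simp: layer_idx_def)
    then have "0 \<le> (2 - norm x) * z * snd w" "(2 - norm x) * z * snd w \<le> 2 * 1 * 1"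
      using z assms(1) by (simp, intro mult_mono) auto
    then show "\<bar>?c\<bar> \<le> 1" by simp
  qed simp
  finally show ?thesis by simp
qed

text \<open>Points with equal parameters stay close when the distance functions are uniformly close.
  So the values are close in the Hausdorff sense, which handles both kinds of subbasic open
  sets.\<close>

lemma continuous_map_reduction:
  fixes \<theta> :: "real^'n \<Rightarrow> real^'n"
  assumes \<theta>: "continuous_on X \<theta>" "\<theta> ` X \<subseteq> cball 0 1"
  shows "continuous_map (vietoris X) (vietoris unit_cube) (\<lambda>K. cube_embed ` layered (\<theta> ` K))"
proof -
  define f where "f K = cube_embed ` layered (\<theta> ` K)" for K
  have sub: "\<theta> ` K \<subseteq> cball 0 1" if "K \<in> hyperspace X" for K using \<theta>(2) that by (auto simp: hyperspace_def)
  have fK: "f K \<in> hyperspace unit_cube" if "K \<in> hyperspace X" for K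
    using cube_embed_layered_subset[OF sub[OF that]]
    by (auto simp: hyperspace_def f_def intro!: compact_continuous_image continuous_on_cube_embed compact_layered)
  have close: "\<exists>N. openin (vietoris X) N \<and> K0 \<in> N \<and> (\<forall>K\<in>N. K \<in> hyperspace X \<and>
      (\<forall>p\<in>f K. \<exists>q\<in>f K0. dist q p < e) \<and> (\<forall>q\<in>f K0. \<exists>p\<in>f K. dist q p < e))"
    if K0: "K0 \<in> hyperspace X" and e: "0 < e" for K0 e
  proof -
    obtain N where N: "openin (vietoris X) N" "K0 \<in> N"
      "\<forall>K\<in>N. \<forall>x. \<bar>infdist x (\<theta> ` K) - infdist x (\<theta> ` K0)\<bar> \<le> e / 2"
      using vietoris_infdist_neighbourhood[OF \<theta>(1) K0, of "e / 2"] e by auto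
    have near: "dist (cube_embed (layer_pt (\<theta> ` K0) x z w)) (cube_embed (layer_pt (\<theta> ` K) x z w)) < e"
      if "K \<in> N" "norm x \<le> 2" "z \<in> heights" "w \<in> layer_idx" for K x z w
    proof -
      have "\<bar>infdist x (\<theta> ` K0) - infdist x (\<theta> ` K)\<bar> \<le> e / 2" using N(3) that(1) by (subst abs_minus_commute) blast
      then show ?thesis using dist_cube_embed_layer_pt[OF that(2-4), of "\<theta> ` K0" "\<theta> ` K"] e by linarith
    qed
    show ?thesis
    proof (intro exI[of _ N] conjI ballI)
      fix K assume K: "K \<in> N"
      show "K \<in> hyperspace X" using openin_subset[OF N(1)] K topspace_vietoris by blast
      show "\<exists>q\<in>f K0. dist q p < e" if "p \<in> f K" for p
      proof -
        obtain x z w where "p = cube_embed (layer_pt (\<theta> ` K) x z w)" "norm x \<le> 2" "z \<in> heights" "w \<in> layer_idx"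
          using \<open>p \<in> f K\<close> unfolding f_def by (auto elim: layeredE)
        then show ?thesis using near[OF K] layer_pt_in_layered[of x z w "\<theta> ` K0"] unfolding f_def by blast
      qed
      show "\<exists>p\<in>f K. dist q p < e" if "q \<in> f K0" for q
      proof -
        obtain x z w where "q = cube_embed (layer_pt (\<theta> ` K0) x z w)" "norm x \<le> 2" "z \<in> heights" "w \<in> layer_idx"
          using \<open>q \<in> f K0\<close> unfolding f_def by (auto elim: layeredE)
        then show ?thesis using near[OF K] layer_pt_in_layered[of x z w "\<theta> ` K"] unfolding f_def by blast
      qed
    qed (use N in auto)
  qed
  have op1: "openin (vietoris X) {K \<in> hyperspace X. f K \<subseteq> U}" if U: "open U" for U
  proof (subst openin_subopen, rule ballI)
    fix K0 assume "K0 \<in> {K \<in> hyperspace X. f K \<subseteq> U}"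
    then have K0: "K0 \<in> hyperspace X" "f K0 \<subseteq> U" by auto
    have "compact (f K0)" using fK[OF K0(1)] by (simp add: hyperspace_def)
    \<comment> \<open>The Lebesgue number of a cover with one member: a uniform neighbourhood of the
      compact set \<open>f K0\<close> inside \<open>U\<close>.\<close>
    then obtain e where e: "0 < e" "\<And>q. q \<in> f K0 \<Longrightarrow> \<exists>G\<in>{U}. ball q e \<subseteq> G"
      using U K0(2) by (elim Heine_Borel_lemma[of _ "{U}"]) auto
    obtain N where N: "openin (vietoris X) N" "K0 \<in> N" "\<forall>K\<in>N. K \<in> hyperspace X \<and>
      (\<forall>p\<in>f K. \<exists>q\<in>f K0. dist q p < e) \<and> (\<forall>q\<in>f K0. \<exists>p\<in>f K. dist q p < e)"
      using close[OF K0(1) e(1)] by (elim exE conjE)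
    have "N \<subseteq> {K \<in> hyperspace X. f K \<subseteq> U}"
    proof
      fix K assume K: "K \<in> N"
      have "p \<in> U" if p: "p \<in> f K" for p
      proof -
        obtain q where "q \<in> f K0" "dist q p < e" using N(3) K p by blast
        then show ?thesis using e(2)[of q] by auto
      qed
      then show "K \<in> {K \<in> hyperspace X. f K \<subseteq> U}" using N(3) K by blast
    qed
    then show "\<exists>T. openin (vietoris X) T \<and> K0 \<in> T \<and> T \<subseteq> {K \<in> hyperspace X. f K \<subseteq> U}" using N(1,2) by blast
  qed
  have op2: "openin (vietoris X) {K \<in> hyperspace X. f K \<inter> U \<noteq> {}}" if U: "open U" for U
  proof (subst openin_subopen, rule ballI)
    fix K0 assume "K0 \<in> {K \<in> hyperspace X. f K \<inter> U \<noteq> {}}"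
    then obtain q where K0: "K0 \<in> hyperspace X" "q \<in> f K0" "q \<in> U" by auto
    obtain e where e: "0 < e" "ball q e \<subseteq> U" using U K0(3) by (elim openE)
    obtain N where N: "openin (vietoris X) N" "K0 \<in> N" "\<forall>K\<in>N. K \<in> hyperspace X \<and>
      (\<forall>p\<in>f K. \<exists>q\<in>f K0. dist q p < e) \<and> (\<forall>q\<in>f K0. \<exists>p\<in>f K. dist q p < e)"
      using close[OF K0(1) e(1)] by (elim exE conjE)
    have "N \<subseteq> {K \<in> hyperspace X. f K \<inter> U \<noteq> {}}"
    proof
      fix K assume K: "K \<in> N"
      then obtain p where "p \<in> f K" "dist q p < e" using N(3) K0(2) by blast
      then have "p \<in> f K \<inter> U" using e(2) by auto
      then show "K \<in> {K \<in> hyperspace X. f K \<inter> U \<noteq> {}}" using N(3) K by blast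
    qed
    then show "\<exists>T. openin (vietoris X) T \<and> K0 \<in> T \<and> T \<subseteq> {K \<in> hyperspace X. f K \<inter> U \<noteq> {}}" using N(1,2) by blast
  qed
  have "continuous_map (vietoris X) (vietoris unit_cube) f"
    unfolding vietoris_def[of "unit_cube :: (real^'n option) set"]
  proof (rule continuous_on_generated_topo)
    show "f ` topspace (vietoris X) \<subseteq> \<Union>({{K \<in> hyperspace unit_cube. K \<subseteq> U} | U. open U} \<union>
        {{K \<in> hyperspace unit_cube. K \<inter> U \<noteq> {}} | U. open U})"
      using fK topspace_vietoris[of "unit_cube :: (real^'n option) set"]
      unfolding topspace_vietoris[of X] vietoris_def topology_generated_by_topspace by blast
    fix S :: "(real^'n option) set set"
    assume "S \<in> {{K \<in> hyperspace unit_cube. K \<subseteq> U} | U. open U} \<union> {{K \<in> hyperspace unit_cube. K \<inter> U \<noteq> {}} | U. open U}"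
    then consider U where "open U" "S = {K \<in> hyperspace unit_cube. K \<subseteq> U}"
      | U where "open U" "S = {K \<in> hyperspace unit_cube. K \<inter> U \<noteq> {}}" by blast
    then show "openin (vietoris X) (f -` S \<inter> topspace (vietoris X))"
    proof cases
      case (1 U)
      have "f -` S \<inter> topspace (vietoris X) = {K \<in> hyperspace X. f K \<subseteq> U}"
        unfolding 1(2) topspace_vietoris using fK by auto
      then show ?thesis using op1[OF 1(1)] by simp
    next
      case (2 U)
      have "f -` S \<inter> topspace (vietoris X) = {K \<in> hyperspace X. f K \<inter> U \<noteq> {}}"
        unfolding 2(2) topspace_vietoris using fK by auto
      then show ?thesis using op2[OF 2(1)] by simp
    qed
  qed
  then show ?thesis unfolding f_def .
qed

section \<open>Dimension of the values and correctness of the reduction\<close>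

lemma cube_embed_layered_homeomorphic: "layered A homeomorphic cube_embed ` layered A"
  by (rule homeomorphic_compact[OF compact_layered continuous_on_cube_embed refl inj_on_subset[OF inj_cube_embed]]) simp

lemma empty_interior_cube_embed_layered: "interior (cube_embed ` layered (A :: (real^'n) set)) = {}"
proof (rule ccontr)
  assume "interior (cube_embed ` layered A) \<noteq> {}"
  then obtain p where "p \<in> interior (cube_embed ` layered A)" by blast
  then obtain e where e: "0 < e" "ball p e \<subseteq> cube_embed ` layered A" by (auto simp: mem_interior)
  define x :: "real^'n" where "x = (\<chi> j. 4 * p $ Some j - 2)"
  have "(\<lambda>s. 4 * (p $ None + s)) ` {0..<e} \<subseteq> {t. (x, t) \<in> layered A}"
  proof (rule image_subsetI, rule CollectI)
    fix s :: real assume "s \<in> {0..<e}"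
    then have s: "0 \<le> s" "s < e" by auto
    have ax: "axis None s = s *\<^sub>R (axis None 1 :: real^'n option)" by (simp add: vec_eq_iff axis_def)
    have "p + axis None s \<in> ball p e" using s by (simp add: dist_norm ax)
    then obtain y t where yt: "(y, t) \<in> layered A" "p + axis None s = cube_embed (y, t)" using e(2) by auto
    have "4 * (p $ None + s) = t" using arg_cong[OF yt(2), of "\<lambda>v. v $ None"] by (simp add: axis_def)
    moreover have "4 * p $ Some j - 2 = y $ j" for j
      using arg_cong[OF yt(2), of "\<lambda>v. v $ Some j"] by (simp add: axis_def)
    then have "x = y" by (simp add: x_def vec_eq_iff)
    ultimately show "(x, 4 * (p $ None + s)) \<in> layered A" using yt(1) by (simp only:)
  qed
  then have "countable ((\<lambda>s. 4 * (p $ None + s)) ` {0..<e})"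
    using countable_layered_fibre countable_subset by blast
  then have "countable {0..<e}" by (rule countable_image_inj_on) (simp add: inj_on_def)
  then show False using uncountable_half_open_interval_1[of 0 e] e(1) by simp
qed

lemma reduction_in_continua_dim:
  fixes A :: "(real^'n) set" and \<theta> :: "real^'n \<Rightarrow> real^'n"
  assumes A: "A \<subseteq> cball 0 1" and \<theta>: "continuous_on unit_cube \<theta>" "inj_on \<theta> unit_cube" "\<theta> ` unit_cube \<subseteq> cball 0 1"
  shows "cube_embed ` layered A \<in> continua_dim CARD('n) unit_cube"
proof -
  let ?Y = "cube_embed ` layered A"
  have cpt: "compact ?Y" by (intro compact_continuous_image continuous_on_cube_embed compact_layered)
  have "connected ?Y" by (intro connected_continuous_image continuous_on_cube_embed connected_layered)
  moreover have "(0, 0) \<in> layered A" using base_subset_layered[of A] by (auto simp: base_def)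
  then have ne: "?Y \<noteq> {}" by blast
  ultimately have "?Y \<in> continua unit_cube"
    unfolding continua_def hyperspace_def using cpt cube_embed_layered_subset[OF A] by simp
  \<comment> \<open>The ambient space is indexed by \<open>'n option\<close>, so its dimension minus
    one is \<open>CARD('n)\<close>.\<close>
  moreover have "covering_dim_le ?Y CARD('n)"
    using covering_dim_le_empty_interior[OF cpt empty_interior_cube_embed_layered] by simp
  \<comment> \<open>Whatever \<open>A\<close> is, the base contains the unit ball at height 0, and
    \<open>\<theta>\<close> places a copy of the cube there.\<close>
  moreover have "\<not> covering_dim_le ?Y (CARD('n) - 1)"
  proof
    assume "covering_dim_le ?Y (CARD('n) - 1)"
    then have "covering_dim_le (unit_cube :: (real^'n) set) (CARD('n) - 1)"
    proof (rule covering_dim_le_injective_image[rotated -1])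
      show "compact (unit_cube :: (real^'n) set)" by (simp add: unit_cube_eq_cbox)
      show "continuous_on unit_cube (\<lambda>x. cube_embed (\<theta> x, 0))"
        by (rule continuous_on_compose2[OF continuous_on_cube_embed[of UNIV]]) (auto intro!: continuous_intros \<theta>(1))
      show "inj_on (\<lambda>x. cube_embed (\<theta> x, 0)) unit_cube"
        by (rule inj_onI) (metis Pair_inject injD[OF inj_cube_embed] inj_onD[OF \<theta>(2)])
      show "(\<lambda>x. cube_embed (\<theta> x, 0)) ` unit_cube \<subseteq> ?Y"
      proof clarify
        fix x :: "real^'n" assume "x \<in> unit_cube"
        then have "norm (\<theta> x) \<le> 1" using \<theta>(3) by auto
        then have "(\<theta> x, 0) \<in> layered A" using base_subset_layered[of A] by (auto simp: base_def)
        then show "cube_embed (\<theta> x, 0) \<in> ?Y" by blast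
      qed
    qed
    with not_covering_dim_le_unit_cube show False by blast
  qed
  ultimately show ?thesis unfolding continua_dim_def covering_dim_eq_def using ne by simp
qed

text \<open>Conjugation by \<open>\<theta>\<close> turns self-homeomorphisms of the cube into those
  of the unit ball, where the layered spaces classify pairs.\<close>

lemma reduction_iff:
  fixes \<theta> :: "real^'n \<Rightarrow> real^'n"
  assumes \<theta>: "homeomorphism unit_cube (cball 0 1) \<theta> \<theta>'" and K: "K \<in> hyperspace unit_cube" "L \<in> hyperspace unit_cube"
  shows "ambient_homeo K L \<longleftrightarrow> cube_embed ` layered (\<theta> ` K) homeomorphic cube_embed ` layered (\<theta> ` L)"
proof -
  have sub: "\<theta> ` M \<subseteq> cball 0 1" "compact (\<theta> ` M)" "\<theta>' ` \<theta> ` M = M" if "M \<in> hyperspace unit_cube" for M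
  proof -
    have M: "compact M" "M \<subseteq> unit_cube" using that by (auto simp: hyperspace_def)
    show "\<theta> ` M \<subseteq> cball 0 1" using homeomorphism_image1[OF \<theta>] M(2) by blast
    show "compact (\<theta> ` M)"
      by (rule compact_continuous_image[OF continuous_on_subset[OF homeomorphism_cont1[OF \<theta>] M(2)] M(1)])
    have "\<And>x. x \<in> M \<Longrightarrow> \<theta>' (\<theta> x) = x" using homeomorphism_apply1[OF \<theta>] M(2) by blast
    then show "\<theta>' ` \<theta> ` M = M" by (simp add: image_image)
  qed
  have "ambient_homeo K L \<longleftrightarrow> (\<exists>g g'. homeomorphism (cball 0 1) (cball 0 1) g g' \<and> g ` \<theta> ` K = \<theta> ` L)"
  proof
    assume "ambient_homeo K L"
    then obtain g h where g: "homeomorphism unit_cube unit_cube g h" "g ` K = L" by (auto simp: ambient_homeo_def)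
    have "homeomorphism (cball 0 1) (cball 0 1) (\<theta> \<circ> (g \<circ> \<theta>')) ((\<theta> \<circ> h) \<circ> \<theta>')"
      by (rule homeomorphism_compose[OF homeomorphism_compose[OF homeomorphism_symD[OF \<theta>] g(1)] \<theta>])
    moreover have "(\<theta> \<circ> (g \<circ> \<theta>')) ` \<theta> ` K = \<theta> ` L"
      using sub(3)[OF K(1)] g(2) by (metis image_comp)
    ultimately show "\<exists>g g'. homeomorphism (cball 0 1) (cball 0 1) g g' \<and> g ` \<theta> ` K = \<theta> ` L" by blast
  next
    assume "\<exists>g g'. homeomorphism (cball 0 1) (cball 0 1) g g' \<and> g ` \<theta> ` K = \<theta> ` L"
    then obtain g h where g: "homeomorphism (cball 0 1) (cball 0 1) g h" "g ` \<theta> ` K = \<theta> ` L" by blast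
    have "homeomorphism unit_cube unit_cube (\<theta>' \<circ> (g \<circ> \<theta>)) ((\<theta>' \<circ> h) \<circ> \<theta>)"
      by (rule homeomorphism_compose[OF homeomorphism_compose[OF \<theta> g(1)] homeomorphism_symD[OF \<theta>]])
    moreover have "(\<theta>' \<circ> (g \<circ> \<theta>)) ` K = L"
      using sub(3)[OF K(2)] g(2) by (metis image_comp)
    ultimately show "ambient_homeo K L" unfolding ambient_homeo_def by blast
  qed
  also have "\<dots> \<longleftrightarrow> layered (\<theta> ` K) homeomorphic layered (\<theta> ` L)"
    using layered_homeomorphic_if_pairs[OF sub(2,1)[OF K(1)]]
      pairs_if_layered_homeomorphic[OF sub(2,1)[OF K(1)] sub(2,1)[OF K(2)]] by metis
  also have "\<dots> \<longleftrightarrow> cube_embed ` layered (\<theta> ` K) homeomorphic cube_embed ` layered (\<theta> ` L)"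
    using cube_embed_layered_homeomorphic[of "\<theta> ` K"] cube_embed_layered_homeomorphic[of "\<theta> ` L"]
    by (meson homeomorphic_trans homeomorphic_sym)
  finally show ?thesis .
qed

theorem theorem3p16:
  shows "borel_reducible
           (vietoris (unit_cube :: (real^'n::finite) set)) ambient_homeo
           (subtopology (vietoris (unit_cube :: (real^('n option)) set))
              (continua_dim CARD('n) (unit_cube :: (real^('n option)) set)))
           (\<lambda>K L. K homeomorphic L)
       \<and> borel_reducible
           (vietoris (unit_cube :: (real^'n::finite) set)) ambient_homeo
           (subtopology (vietoris (unit_cube :: (real^('n option)) set))
              (continua (unit_cube :: (real^('n option)) set)))
           (\<lambda>K L. K homeomorphic L)"
proof -
  let ?Q = "unit_cube :: (real^'n) set"
  have "(\<chi> i. 1/2) \<in> box 0 (1::real^'n)" by (simp add: mem_box_cart)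
  then have "interior ?Q \<noteq> {}" unfolding unit_cube_eq_cbox interior_cbox by blast
  then have "?Q homeomorphic cball (0::real^'n) 1"
    by (intro homeomorphic_convex_compact_cball) (auto simp: unit_cube_eq_cbox)
  then obtain \<theta> \<theta>' where \<theta>: "homeomorphism ?Q (cball (0::real^'n) 1) \<theta> \<theta>'" by (auto simp: homeomorphic_def)
  have \<theta>im: "\<theta> ` ?Q = cball 0 1" and cont: "continuous_on ?Q \<theta>"
    using homeomorphism_image1[OF \<theta>] homeomorphism_cont1[OF \<theta>] by auto
  have inj: "inj_on \<theta> ?Q" using \<theta> by (metis homeomorphism_def inj_on_inverseI)
  define f where "f K = cube_embed ` layered (\<theta> ` K)" for K
  have cm: "continuous_map (vietoris ?Q) (vietoris unit_cube) f"
    unfolding f_def by (rule continuous_map_reduction[OF cont]) (simp add: \<theta>im)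
  have dim: "f K \<in> continua_dim CARD('n) unit_cube" if "K \<in> hyperspace ?Q" for K
    unfolding f_def using that \<theta>im by (intro reduction_in_continua_dim[OF _ cont inj]) (auto simp: hyperspace_def)
  \<comment> \<open>The same map serves both targets, since its values lie in the smaller one;
    \<open>Z\<close> stands for either.\<close>
  have "borel_reducible (vietoris ?Q) ambient_homeo (subtopology (vietoris unit_cube) Z) (\<lambda>K L. K homeomorphic L)"
    if Z: "continua_dim CARD('n) unit_cube \<subseteq> Z" for Z :: "(real^'n option) set set"
    unfolding borel_reducible_def
  proof (intro exI[of _ f] conjI ballI)
    have "continuous_map (vietoris ?Q) (subtopology (vietoris unit_cube) Z) f"
      using cm dim Z by (auto simp: continuous_map_in_subtopology topspace_vietoris)
    then show "f \<in> measurable (borel_of_top (vietoris ?Q)) (borel_of_top (subtopology (vietoris unit_cube) Z))"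
      by (rule borel_of_top_measurable)
    show "ambient_homeo K L \<longleftrightarrow> f K homeomorphic f L" if "K \<in> topspace (vietoris ?Q)" "L \<in> topspace (vietoris ?Q)" for K L
      using that reduction_iff[OF \<theta>] unfolding f_def topspace_vietoris by blast
  qed
  moreover have "continua_dim CARD('n) unit_cube \<subseteq> continua (unit_cube :: (real^'n option) set)"
    by (auto simp: continua_dim_def)
  ultimately show ?thesis by blast
qed

end
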